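(* Consider the problem, the i.i.d. sampling and multiplicative noise assumptions, and Algorithm 2 described in the context. Let $\mu\in(0,1)$ and $\phi\in(0,1)$ such that $\phi\in(0,1-\mu c/L)$. Choose $\zeta\in(0,1)$ and $N_0\in\mathbb{N}$, and set $\alpha_t\equiv\alpha:=\frac{\mu}{L}$ and $N_t:=N_0\lceil\zeta^{-t}\rceil$ for $t\in\mathbb{N}$. Define $$\rho:=\max\left\{1-\mu\frac{c}{2L}+\phi,\ \zeta\right\}<1 .$$ Let $\{x^t\}$ be generated by Algorithm 2 with these parameters. Then there exists a constant $\mathsf{A}>0$ such that, for given $\epsilon>0$, Algorithm 2 achieves the tolerance $\mathbb{E}[g(x^T)-g^*]\le\epsilon$ after $T=\mathcal{O}\left(\log_{\frac1\rho}(\mathsf{A}\epsilon^{-1})\right)$ iterations using an oracle complexity (total number of samples) of $$\sum_{\tau=1}^TN_\tau\le\frac{N_0\,\rho\cdot\mathcal{O}(\epsilon^{-1})}{1-\zeta}\cdot\left(\frac{\rho}{\zeta}\right)^{\log_{\frac1\rho}(\mathsf{A}\epsilon^{-1})+1}.$$ In particular, if the stepsize parameter $\mu$ and the sampling rate parameter $\zeta$ satisfy $\zeta=1-\mathsf{a}\left(\mu\frac{c}{2L}+\phi\right)$ for some $\mathsf{a}\in(0,1]$, then the oracle complexity is $$\sum_{\tau=1}^TN_\tau\le\frac{N_0\,\rho\cdot\mathcal{O}(\epsilon^{-1})}{\mathsf{a}\left(\mu\frac{c}{2L}+\phi\right)}.$$ Up to constants, the same oracle complexity is achieved for the iteration error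 $\mathbb{E}[\|x^T-x^*\|^2]$, where $x^*$ is the unique solution of $\min_{x\in X}g(x)$.
   Context: The $\mathcal{O}(\cdot)$ symbols refer to $\epsilon\to0^+$, with constants not depending on $\epsilon$. Setting. $\mathbb{N}=\{1,2,\dots\}$; $\lceil x\rceil$ is the smallest integer $\ge x$; $\|\cdot\|$ is the Euclidean norm. $X\subset\mathbb{R}^d$ is closed and convex, $\mathbf{P}$ is a probability distribution on $\Xi$, and $F:X\times\Xi\to\mathbb{R}$ is measurable, such that for a.e. $\xi$ the function $F(\cdot,\xi)$ is convex and continuously differentiable, and $F(x,\cdot)$, $\nabla F(x,\cdot)$ are integrable for every $x\in X$. Here $\nabla F$ is the gradient in $x$. Set $f(x):=\mathbb{E}[F(x,\xi)]$ with $\xi\sim\mathbf{P}$; $f$ is differentiable on $X$ with $\nabla f(x)=\mathbb{E}[\nabla F(x,\xi)]$, and for some $L>0$ and $c>0$, $\|\nabla f(x)-\nabla f(y)\|\le L\|x-y\|$ and $f(x)+\langle\nabla f(x),y-x\rangle+\frac c2\|y-x\|^2\le f(y)$ for all $x,y\in X$. $\varphi:X\to\mathbb{R}$ is a (possibly nonsmooth) convex function whose proximal minimizations (as in the algorithm below) are well defined. The problem is $g^*:=\min_{x\in X}\{g(x):=f(x)+\varphi(x)\}$, which has a unique solution $x^*$. Multiplicative noise assumption. Let $\sigma(x):=\sqrt{\mathbb{E}[\|\nabla F(x,\xi)-\nabla f(x)\|^2]}$. There is $x^0\in X$ with $\sigma(x^0)<\infty$, and there is $\sigma_L>0$ such that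 $\sigma(x)\le\sigma(y)+\sigma_L\|x-y\|$ for all $x,y\in X$. Algorithm 2. Inputs: initial point $x^1\in X$, stepsizes $\alpha_t>0$, batch sizes $N_t\in\mathbb{N}$. At iteration $t\ge1$, given $x^t$, draw an i.i.d. sample $\xi^t=\{\xi^t_j\}_{j=1}^{N_t}$ from $\mathbf{P}$, independent of all previous samples, put $F'_t(x^t,\xi^t):=\frac1{N_t}\sum_{j=1}^{N_t}\nabla F(x^t,\xi^t_j)$ and $$x^{t+1}:=\operatorname*{argmin}_{x\in X}\left\{f(x^t)+\langle F'_t(x^t,\xi^t),x-x^t\rangle+\frac1{2\alpha_t}\|x-x^t\|^2+\varphi(x)\right\}.$$
   Formalization: The inequality ρ<1 is taken as a hypothesis: it does not follow from φ∈(0,1-μc/L) (e.g. c=L, μ=0.1, φ=0.5 gives ρ≥1.45), and without it the logarithm to base 1/ρ and the stated bounds break down. *)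

theory Defs
  imports "HOL-Probability.Probability" "HOL-Library.Landau_Symbols"
begin

text \<open>
  A stochastic objective \<open>F\<close> is a function of a decision \<open>x\<close> and a scenario \<open>s\<close>, where \<open>s\<close> is
  distributed according to \<open>P\<close>; \<open>gF x s\<close> is its gradient in \<open>x\<close>. The gradient map is a parameter,
  constrained by \<open>has_gradient_on\<close> below, because the feasible set \<open>X\<close> may have empty interior, in
  which case the derivative within \<open>X\<close> does not determine a unique gradient vector.
\<close>

definition has_gradient_on ::
  "('a::euclidean_space \<Rightarrow> real) \<Rightarrow> ('a \<Rightarrow> 'a) \<Rightarrow> 'a set \<Rightarrow> bool" where
  "has_gradient_on h gh X \<longleftrightarrow>
     (\<forall>x\<in>X. (h has_derivative (\<lambda>v. gh x \<bullet> v)) (at x within X))"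

definition mean_obj :: "'b measure \<Rightarrow> ('a::euclidean_space \<Rightarrow> 'b \<Rightarrow> real) \<Rightarrow> 'a \<Rightarrow> real" where
  "mean_obj P F x = (\<integral>s. F x s \<partial>P)"

definition mean_grad :: "'b measure \<Rightarrow> ('a::euclidean_space \<Rightarrow> 'b \<Rightarrow> 'a) \<Rightarrow> 'a \<Rightarrow> 'a" where
  "mean_grad P gF x = (\<integral>s. gF x s \<partial>P)"

definition composite_obj ::
  "'b measure \<Rightarrow> ('a::euclidean_space \<Rightarrow> 'b \<Rightarrow> real) \<Rightarrow> ('a \<Rightarrow> real) \<Rightarrow> 'a \<Rightarrow> real" where
  "composite_obj P F \<phi> x = mean_obj P F x + \<phi> x"

definition optimal_value ::
  "'a::euclidean_space set \<Rightarrow> 'b measure \<Rightarrow> ('a \<Rightarrow> 'b \<Rightarrow> real) \<Rightarrow> ('a \<Rightarrow> real) \<Rightarrow> real" where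
  "optimal_value X P F \<phi> = (INF x\<in>X. composite_obj P F \<phi> x)"

text \<open>
  The objective of one proximal step from \<open>y\<close> with stepsize \<open>\<alpha>\<close> along the direction \<open>v\<close>.
\<close>

definition prox_obj ::
  "('a::euclidean_space \<Rightarrow> real) \<Rightarrow> ('a \<Rightarrow> real) \<Rightarrow> real \<Rightarrow> 'a \<Rightarrow> 'a \<Rightarrow> 'a \<Rightarrow> real" where
  "prox_obj f \<phi> \<alpha> y v x =
     f y + v \<bullet> (x - y) + 1 / (2 * \<alpha>) * (norm (x - y))\<^sup>2 + \<phi> x"

locale composite_problem =
  fixes X :: "'a::euclidean_space set"
    and P :: "'b measure"
    and F :: "'a \<Rightarrow> 'b \<Rightarrow> real"
    and gF :: "'a \<Rightarrow> 'b \<Rightarrow> 'a"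
    and \<phi> :: "'a \<Rightarrow> real"
    and L c :: real
  assumes closed_X: "closed X"
    and convex_X: "convex X"
    and prob_P: "prob_space P"
    and F_measurable:
      "(\<lambda>(x, s). F x s) \<in> borel_measurable (restrict_space borel X \<Otimes>\<^sub>M P)"
    and F_convex_C1:
      "AE s in P. convex_on X (\<lambda>x. F x s)
         \<and> has_gradient_on (\<lambda>x. F x s) (\<lambda>x. gF x s) X
         \<and> continuous_on X (\<lambda>x. gF x s)"
    and F_integrable: "\<And>x. x \<in> X \<Longrightarrow> integrable P (F x)"
    and gF_integrable: "\<And>x. x \<in> X \<Longrightarrow> integrable P (gF x)"
    and mean_gradient: "has_gradient_on (mean_obj P F) (mean_grad P gF) X"
    and L_pos: "L > 0"
    and c_pos: "c > 0"
    and gradient_lipschitz: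
      "\<And>x y. x \<in> X \<Longrightarrow> y \<in> X \<Longrightarrow>
         norm (mean_grad P gF x - mean_grad P gF y) \<le> L * norm (x - y)"
    and strongly_convex:
      "\<And>x y. x \<in> X \<Longrightarrow> y \<in> X \<Longrightarrow>
         mean_obj P F x + mean_grad P gF x \<bullet> (y - x) + c / 2 * (norm (y - x))\<^sup>2
           \<le> mean_obj P F y"
    and \<phi>_convex: "convex_on X \<phi>"
    and prox_well_defined:
      "\<And>\<alpha> y v. \<alpha> > 0 \<Longrightarrow> y \<in> X \<Longrightarrow>
         \<exists>!z. is_arg_min (prox_obj (mean_obj P F) \<phi> \<alpha> y v) (\<lambda>x. x \<in> X) z"
    and unique_solution: "\<exists>!z. is_arg_min (composite_obj P F \<phi>) (\<lambda>x. x \<in> X) z"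

text \<open>
  The standard deviation of the gradient at \<open>x\<close>, as an extended real. The infinite value is
  explicit because the Bochner integral of a non-integrable function is zero.
\<close>

definition noise_sd ::
  "'b measure \<Rightarrow> ('a::euclidean_space \<Rightarrow> 'b \<Rightarrow> 'a) \<Rightarrow> 'a \<Rightarrow> ennreal" where
  "noise_sd P gF x =
     (if integrable P (\<lambda>s. (norm (gF x s - mean_grad P gF x))\<^sup>2)
      then ennreal (sqrt (\<integral>s. (norm (gF x s - mean_grad P gF x))\<^sup>2 \<partial>P))
      else \<infinity>)"

definition multiplicative_noise ::
  "'a::euclidean_space set \<Rightarrow> 'b measure \<Rightarrow> ('a \<Rightarrow> 'b \<Rightarrow> 'a) \<Rightarrow> real \<Rightarrow> bool" where
  "multiplicative_noise X P gF \<sigma>L \<longleftrightarrow>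
     (\<exists>x0\<in>X. noise_sd P gF x0 < \<infinity>) \<and> \<sigma>L > 0 \<and>
     (\<forall>x\<in>X. \<forall>y\<in>X. noise_sd P gF x \<le> noise_sd P gF y + ennreal (\<sigma>L * norm (x - y)))"

text \<open>
  Iterations are numbered from 1. The sample drawn at iteration \<open>t\<close> is \<open>\<xi> t 1, \<dots>, \<xi> t (N t)\<close>;
  independence is joint over all iterations.
\<close>

definition iid_samples ::
  "'w measure \<Rightarrow> 'b measure \<Rightarrow> (nat \<Rightarrow> nat) \<Rightarrow> (nat \<Rightarrow> nat \<Rightarrow> 'w \<Rightarrow> 'b) \<Rightarrow> bool" where
  "iid_samples M P N \<xi> \<longleftrightarrow>
     prob_space.indep_vars M (\<lambda>_. P) (\<lambda>(t, j). \<xi> t j) {(t, j). 1 \<le> t \<and> 1 \<le> j \<and> j \<le> N t} \<and>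
     (\<forall>t j. 1 \<le> t \<and> 1 \<le> j \<and> j \<le> N t \<longrightarrow> distr M P (\<xi> t j) = P)"

definition batch_grad ::
  "('a::euclidean_space \<Rightarrow> 'b \<Rightarrow> 'a) \<Rightarrow> nat \<Rightarrow> (nat \<Rightarrow> 'b) \<Rightarrow> 'a \<Rightarrow> 'a" where
  "batch_grad gF n s y = (1 / real n) *\<^sub>R (\<Sum>j=1..n. gF y (s j))"

definition stochastic_prox_gradient ::
  "'w measure \<Rightarrow> 'a::euclidean_space set \<Rightarrow> 'b measure \<Rightarrow> ('a \<Rightarrow> 'b \<Rightarrow> real) \<Rightarrow> ('a \<Rightarrow> 'b \<Rightarrow> 'a)
     \<Rightarrow> ('a \<Rightarrow> real) \<Rightarrow> (nat \<Rightarrow> real) \<Rightarrow> (nat \<Rightarrow> nat) \<Rightarrow> (nat \<Rightarrow> nat \<Rightarrow> 'w \<Rightarrow> 'b) \<Rightarrow> 'a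
     \<Rightarrow> (nat \<Rightarrow> 'w \<Rightarrow> 'a) \<Rightarrow> bool" where
  "stochastic_prox_gradient M X P F gF \<phi> \<alpha> N \<xi> x1 x \<longleftrightarrow>
     iid_samples M P N \<xi> \<and>
     x1 \<in> X \<and>
     (\<forall>t\<ge>1. x t \<in> borel_measurable M) \<and>
     (\<forall>\<omega>\<in>space M. x 1 \<omega> = x1) \<and>
     (\<forall>t\<ge>1. \<forall>\<omega>\<in>space M.
        is_arg_min
          (prox_obj (mean_obj P F) \<phi> (\<alpha> t) (x t \<omega>)
             (batch_grad gF (N t) (\<lambda>j. \<xi> t j \<omega>) (x t \<omega>)))
          (\<lambda>z. z \<in> X) (x (t + 1) \<omega>))"

definition batch_size :: "nat \<Rightarrow> real \<Rightarrow> nat \<Rightarrow> nat" where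
  "batch_size N0 \<zeta> t = N0 * nat \<lceil>\<zeta> powr (- real t)\<rceil>"

text \<open>
  A real random variable \<open>Y\<close> has expectation at most \<open>b\<close>; integrability is required because
  otherwise the Bochner integral would be zero.
\<close>

definition expectation_le :: "'w measure \<Rightarrow> ('w \<Rightarrow> real) \<Rightarrow> real \<Rightarrow> bool" where
  "expectation_le M Y b \<longleftrightarrow> integrable M Y \<and> (\<integral>\<omega>. Y \<omega> \<partial>M) \<le> b"

end

theory Submission
  imports Defs
begin

text \<open>
  Let \<open>q = 1 - \<mu> c / L\<close>, and let \<open>u t\<close> be the mean squared distance of the \<open>t\<close>-th iterate to the
  solution. With \<open>e\<close> the error of the batch gradient, strong convexity, the quadratic upper bound for \<open>f\<close>
  and the strong convexity of the proximal objective combine, sample by sample, to a contraction with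
  factor \<open>q\<close> perturbed by a term linear in \<open>e\<close> and a term of order \<open>|e|\<^sup>2\<close> (\<open>prox_gradient_step\<close>). Given
  the past, the batch is fresh: the linear term averages to zero, and since the standard deviation of
  the noise is Lipschitz, the mean of \<open>|e|\<^sup>2\<close> is at most \<open>(a + b u t) / N t\<close>
  (\<open>batch_noise\<close>, \<open>expected_step\<close>). As \<open>1 / N t \<le> \<zeta> ^ t\<close>, this gives
    \<open>u (t + 1) \<le> (q + O(\<zeta> ^ t)) u t + O(\<zeta> ^ t)\<close>,
  and hence \<open>u t = O(r ^ t)\<close> for every \<open>r > q\<close> with \<open>r \<ge> \<zeta>\<close> (\<open>perturbed_contraction_rate\<close>). The same
  one-step inequality bounds the objective gap after a step by the squared distances before and after
  it and \<open>|e|\<^sup>2\<close>, so the gap decays at the same rate.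
  
  Reaching the accuracy \<open>\<epsilon>\<close> takes about \<open>log (A / \<epsilon>)\<close> iterations, to the base \<open>1 / r\<close>, and a number of
  samples at most proportional to \<open>(1 / \<zeta>) ^ T\<close> (\<open>geometric_rate_complexity\<close>). The value \<open>r = \<rho>\<close> is always
  possible and gives the first sample bound. For the second one it does not suffice: under
  \<open>\<zeta> = 1 - a (\<mu> c / (2 L) + \<theta>)\<close> the rate \<open>\<zeta>\<close> may be smaller than \<open>\<rho>\<close>, and the excess factor
  \<open>(\<rho> / \<zeta>) ^ T\<close> is then unbounded. But \<open>\<rho> < 1\<close> implies \<open>\<theta> < \<mu> c / (2 L)\<close>, and
  with \<open>a \<le> 1\<close> this gives \<open>\<zeta> > q\<close>; therefore
  \<open>r = \<zeta>\<close> is possible and the excess factor disappears. One number of iterations has to serve both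
  bounds, so \<open>r = \<zeta>\<close> is taken whenever \<open>\<zeta> > q\<close>.
  
  Measurability needs two observations. The stochastic gradient is continuous on \<open>X\<close> only for almost all
  scenarios; it is replaced by a jointly measurable version, which changes the iterates on a null set
  only. And \<open>\<phi>\<close> itself need not be Borel on the boundary of \<open>X\<close>, but it is lower semicontinuous at
  every point that a proximal step can reach.
\<close>

section \<open>The proximal map\<close>

text \<open>
  Up to an additive constant, the objective of one step from \<open>y\<close> along \<open>v\<close> is
  \<open>\<phi>\<close> plus a quadratic centred at \<open>u = y - \<alpha> v\<close>. The new iterate therefore depends on
  \<open>(y, v)\<close> only through \<open>u\<close>, and it is the proximal point of \<open>u\<close>.
\<close>

definition is_prox :: "'a::euclidean_space set \<Rightarrow> ('a \<Rightarrow> real) \<Rightarrow> real \<Rightarrow> 'a \<Rightarrow> 'a \<Rightarrow> bool" where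
  "is_prox X \<phi> \<alpha> u z \<longleftrightarrow>
     is_arg_min (\<lambda>x. \<phi> x + 1 / (2 * \<alpha>) * (norm (x - u))\<^sup>2) (\<lambda>x. x \<in> X) z"

lemma is_prox_D:
  assumes "is_prox X \<phi> \<alpha> u z"
  shows "z \<in> X"
    and "y \<in> X \<Longrightarrow> \<phi> z + 1 / (2 * \<alpha>) * (norm (z - u))\<^sup>2 \<le> \<phi> y + 1 / (2 * \<alpha>) * (norm (y - u))\<^sup>2"
  using assms unfolding is_prox_def is_arg_min_def by (auto simp: not_less)

lemma prox_obj_complete_square:
  assumes "\<alpha> > 0"
  shows "prox_obj f \<phi> \<alpha> y v x =
    \<phi> x + 1 / (2 * \<alpha>) * (norm (x - (y - \<alpha> *\<^sub>R v)))\<^sup>2 + (f y - \<alpha> / 2 * (norm v)\<^sup>2)"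
proof -
  have "(norm (x - (y - \<alpha> *\<^sub>R v)))\<^sup>2 =
      (norm (x - y))\<^sup>2 + 2 * \<alpha> * (v \<bullet> (x - y)) + \<alpha>\<^sup>2 * (norm v)\<^sup>2"
    unfolding power2_norm_eq_inner
    by (simp add: inner_diff_left inner_diff_right inner_commute algebra_simps power2_eq_square)
  then show ?thesis
    using assms unfolding prox_obj_def by (simp add: field_simps power2_eq_square)
qed

lemma is_arg_min_prox_obj_iff:
  assumes "\<alpha> > 0"
  shows "is_arg_min (prox_obj f \<phi> \<alpha> y v) (\<lambda>x. x \<in> X) z \<longleftrightarrow> is_prox X \<phi> \<alpha> (y - \<alpha> *\<^sub>R v) z"
  unfolding is_prox_def is_arg_min_def prox_obj_complete_square[OF assms] by simp

lemma norm_convex_combination: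
  fixes z y u :: "'a::real_inner"
  shows "(norm ((1 - t) *\<^sub>R z + t *\<^sub>R y - u))\<^sup>2 =
    (1 - t) * (norm (z - u))\<^sup>2 + t * (norm (y - u))\<^sup>2 - t * (1 - t) * (norm (y - z))\<^sup>2"
  unfolding power2_norm_eq_inner
  by (simp add: inner_diff_left inner_diff_right inner_add_left inner_add_right inner_commute
      algebra_simps power2_eq_square)

text \<open>
  The proximal objective is strongly convex with modulus \<open>1 / \<alpha>\<close>, so it exceeds its minimum by at
  least \<open>1 / (2 \<alpha>)\<close> times the squared distance to the minimiser. This is seen by comparing the
  minimiser \<open>z\<close> with the points of the segment from \<open>z\<close> to \<open>y\<close> and letting them tend to \<open>z\<close>.
\<close>

lemma prox_three_point:
  assumes \<phi>: "convex_on X \<phi>" and \<alpha>: "\<alpha> > 0" and z: "is_prox X \<phi> \<alpha> u z" and y: "y \<in> X"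
  shows "\<phi> z + 1 / (2 * \<alpha>) * (norm (z - u))\<^sup>2 + 1 / (2 * \<alpha>) * (norm (y - z))\<^sup>2
    \<le> \<phi> y + 1 / (2 * \<alpha>) * (norm (y - u))\<^sup>2"
proof -
  define b where "b = 1 / (2 * \<alpha>)"
  have zX: "z \<in> X"
    using z by (rule is_prox_D)
  have "s * (b * (norm (y - z))\<^sup>2) \<le> \<phi> y + b * (norm (y - u))\<^sup>2 - (\<phi> z + b * (norm (z - u))\<^sup>2)"
    if s: "0 < s" "s < 1" for s
  proof -
    define t where "t = 1 - s"
    have t: "0 < t" "t < 1" "s = 1 - t"
      using s by (auto simp: t_def)
    define w where "w = (1 - t) *\<^sub>R z + t *\<^sub>R y"
    have "w \<in> X"
      unfolding w_def using t zX y convex_on_imp_convex[OF \<phi>] by (intro convexD) auto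
    then have "\<phi> z + b * (norm (z - u))\<^sup>2 \<le> \<phi> w + b * (norm (w - u))\<^sup>2"
      unfolding b_def using z by (rule is_prox_D(2)[rotated])
    also have "\<phi> w \<le> (1 - t) * \<phi> z + t * \<phi> y"
      unfolding w_def using t by (intro convex_onD[OF \<phi>] zX y) auto
    finally have "t * (s * (b * (norm (y - z))\<^sup>2)) \<le>
        t * (\<phi> y + b * (norm (y - u))\<^sup>2 - (\<phi> z + b * (norm (z - u))\<^sup>2))"
      unfolding w_def norm_convex_combination t(3) by (simp add: algebra_simps)
    then show ?thesis
      using t(1) by simp
  qed
  from field_le_mult_one_interval[OF this] show ?thesis
    unfolding b_def by linarith
qed

text \<open>
  Adding the three-point inequalities of the two proximal points cancels \<open>\<phi>\<close>. Nonexpansiveness gives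
  both the uniqueness of proximal points and the continuity, hence Borel measurability, of the
  proximal map.
\<close>

lemma prox_nonexpansive:
  assumes \<phi>: "convex_on X \<phi>" and \<alpha>: "\<alpha> > 0"
    and z: "is_prox X \<phi> \<alpha> u z" and z': "is_prox X \<phi> \<alpha> u' z'"
  shows "norm (z - z') \<le> norm (u - u')"
proof -
  have "1 / (2 * \<alpha>) * ((norm (z - u))\<^sup>2 + (norm (z' - u'))\<^sup>2 + 2 * (norm (z - z'))\<^sup>2)
     \<le> 1 / (2 * \<alpha>) * ((norm (z' - u))\<^sup>2 + (norm (z - u'))\<^sup>2)"
    using prox_three_point[OF \<phi> \<alpha> z is_prox_D(1)[OF z']]
      prox_three_point[OF \<phi> \<alpha> z' is_prox_D(1)[OF z]]
    by (simp add: algebra_simps norm_minus_commute)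
  then have "(norm (z - u))\<^sup>2 + (norm (z' - u'))\<^sup>2 + 2 * (norm (z - z'))\<^sup>2
     \<le> (norm (z' - u))\<^sup>2 + (norm (z - u'))\<^sup>2"
    using \<alpha> by (simp add: divide_le_cancel)
  then have "(norm (z - z'))\<^sup>2 \<le> (u - u') \<bullet> (z - z')"
    unfolding power2_norm_eq_inner
    by (simp add: inner_diff_left inner_diff_right inner_commute)
  also have "\<dots> \<le> norm (u - u') * norm (z - z')"
    by (rule norm_cauchy_schwarz)
  finally show ?thesis
    by (cases "norm (z - z') = 0") (auto simp: power2_eq_square)
qed

text \<open>
  A convex \<open>\<phi>\<close> can be discontinuous, even non-Borel, on the relative boundary of \<open>X\<close>. At a proximal
  point \<open>z\<close> of \<open>u\<close>, however, minimality says that \<open>\<phi>\<close> lies above a continuous function that agrees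
  with it at \<open>z\<close>. So \<open>\<phi>\<close> is lower semicontinuous at every proximal point, and its composition with a
  measurable map whose values are proximal points is measurable.
\<close>

lemma prox_value_measurable:
  assumes \<alpha>: "\<alpha> > 0" and Z[measurable]: "Z \<in> borel_measurable M"
    and prox: "\<And>\<omega>. \<omega> \<in> space M \<Longrightarrow> \<exists>u. is_prox X \<phi> \<alpha> u (Z \<omega>)"
  shows "(\<lambda>\<omega>. \<phi> (Z \<omega>)) \<in> borel_measurable M"
proof (subst borel_measurable_iff_greater, intro allI)
  fix a :: real
  define U where "U = \<Union>{V. open V \<and> (\<forall>y\<in>V \<inter> X. a < \<phi> y)}"
  have "open U"
    unfolding U_def by auto
  have "a < \<phi> (Z \<omega>) \<longleftrightarrow> Z \<omega> \<in> U" if \<omega>: "\<omega> \<in> space M" for \<omega>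
  proof
    obtain u where u: "is_prox X \<phi> \<alpha> u (Z \<omega>)"
      using prox[OF \<omega>] by blast
    let ?m = "\<lambda>y. \<phi> (Z \<omega>) + 1 / (2 * \<alpha>) * (norm (Z \<omega> - u))\<^sup>2 - 1 / (2 * \<alpha>) * (norm (y - u))\<^sup>2"
    {
      assume "a < \<phi> (Z \<omega>)"
      have "open {y. a < ?m y}"
        by (intro open_Collect_less continuous_intros)
      moreover have "a < \<phi> y" if "y \<in> {y. a < ?m y} \<inter> X" for y
        using that is_prox_D(2)[OF u, of y] by auto
      moreover have "Z \<omega> \<in> {y. a < ?m y}"
        using \<open>a < \<phi> (Z \<omega>)\<close> by simp
      ultimately show "Z \<omega> \<in> U"
        unfolding U_def by blast
    }
    assume "Z \<omega> \<in> U"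
    then show "a < \<phi> (Z \<omega>)"
      unfolding U_def using is_prox_D(1)[OF u] by blast
  qed
  then have "{\<omega> \<in> space M. a < \<phi> (Z \<omega>)} = Z -` U \<inter> space M"
    by auto
  also have "\<dots> \<in> sets M"
    using \<open>open U\<close> by (intro measurable_sets[OF Z]) auto
  finally show "{\<omega> \<in> space M. a < \<phi> (Z \<omega>)} \<in> sets M" .
qed

section \<open>One proximal gradient step with an inexact gradient\<close>

text \<open>
  The constant \<open>L / 2\<close>, rather than the \<open>L\<close> that convexity alone would give, is what leaves a positive
  multiple of \<open>|z - y|\<^sup>2\<close> to spare in the next lemma for every stepsize \<open>\<mu> / L\<close> with \<open>\<mu> < 1\<close>. The
  proof applies the mean value theorem to the defect along the segment, within \<open>X\<close>, because \<open>X\<close> may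
  have empty interior.
\<close>

lemma lipschitz_gradient_upper_bound:
  assumes X: "convex X" and f: "has_gradient_on f gf X"
    and lip: "\<And>y z. y \<in> X \<Longrightarrow> z \<in> X \<Longrightarrow> norm (gf y - gf z) \<le> L * norm (y - z)"
    and x: "x \<in> X" and y: "y \<in> X"
  shows "f y \<le> f x + gf x \<bullet> (y - x) + L / 2 * (norm (y - x))\<^sup>2"
proof -
  define w where "w = y - x"
  define h where "h t = f (x + t *\<^sub>R w) - t * (gf x \<bullet> w) - L / 2 * t\<^sup>2 * (norm w)\<^sup>2" for t :: real
  define h' where "h' t v = gf (x + t *\<^sub>R w) \<bullet> (v *\<^sub>R w) - v * (gf x \<bullet> w) - L * t * v * (norm w)\<^sup>2"
    for t v :: real
  have seg: "x + t *\<^sub>R w \<in> X" if "0 \<le> t" "t \<le> 1" for t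
    using convexD_alt[OF X x y that] by (simp add: w_def algebra_simps)
  have "(h has_derivative h' t) (at t within {0..1})" if "0 \<le> t" "t \<le> 1" for t
  proof -
    have "((\<lambda>t. f (x + t *\<^sub>R w)) has_derivative (\<lambda>v. gf (x + t *\<^sub>R w) \<bullet> (v *\<^sub>R w))) (at t within {0..1})"
    proof (rule has_derivative_in_compose2[where t=X])
      show "(f has_derivative (\<bullet>) (gf z)) (at z within X)" if "z \<in> X" for z
        using f that unfolding has_gradient_on_def by auto
      show "((\<lambda>t. x + t *\<^sub>R w) has_derivative (\<lambda>v. v *\<^sub>R w)) (at t within {0..1})"
        by (auto intro!: derivative_eq_intros)
    qed (use seg that in auto)
    then show ?thesis
      unfolding h_def h'_def by (auto intro!: derivative_eq_intros)
  qed
  then obtain t where t: "t \<in> {0<..<1}" and eq: "h 1 - h 0 = h' t (1 - 0)"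
    using mvt_simple[of 0 1 h h'] by auto
  have "h' t (1 - 0) = (gf (x + t *\<^sub>R w) - gf x) \<bullet> w - L * t * (norm w)\<^sup>2"
    by (simp add: h'_def inner_diff_left)
  also have "(gf (x + t *\<^sub>R w) - gf x) \<bullet> w \<le> norm (gf (x + t *\<^sub>R w) - gf x) * norm w"
    by (rule norm_cauchy_schwarz)
  also have "\<dots> \<le> (L * norm (x + t *\<^sub>R w - x)) * norm w"
    using t x seg[of t] by (intro mult_right_mono lip) auto
  also have "\<dots> = L * t * (norm w)\<^sup>2"
    using t by (simp add: power2_eq_square)
  finally have "h 1 \<le> h 0"
    using eq by linarith
  then show ?thesis
    by (simp add: h_def w_def)
qed

text \<open>
  The step is analysed for an arbitrary direction \<open>v\<close> with error \<open>e = v - \<nabla>f(y)\<close>. The three-point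
  inequality at the solution, the upper quadratic bound at \<open>z\<close> and the strongly convex lower bound at
  the solution together bound the gap \<open>g(z) - g(xs)\<close>. Discarding the gap, which is nonnegative, yields
  the contraction; discarding the nonpositive terms yields the bound on the gap.
  
  In the contraction the error enters linearly only through \<open>e \<bullet> (y - xs)\<close>, where \<open>y - xs\<close> does not
  depend on the sample that produces \<open>e\<close>; this term vanishes in expectation.
\<close>

lemma (in composite_problem) prox_gradient_step:
  assumes \<mu>: "0 < \<mu>" "\<mu> < 1"
    and opt: "is_arg_min (composite_obj P F \<phi>) (\<lambda>z. z \<in> X) xs"
    and y: "y \<in> X"
    and z: "is_prox X \<phi> (\<mu> / L) (y - (\<mu> / L) *\<^sub>R v) z"
  defines "e \<equiv> v - mean_grad P gF y"
  shows "(norm (z - xs))\<^sup>2 \<le> (1 - \<mu> * c / L) * (norm (y - xs))\<^sup>2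
      - 2 * (\<mu> / L) * (e \<bullet> (y - xs)) + (\<mu> / L)\<^sup>2 / (1 - \<mu>) * (norm e)\<^sup>2" (is ?contraction)
    and "composite_obj P F \<phi> z - composite_obj P F \<phi> xs
      \<le> (norm e)\<^sup>2 / 2 + (norm (z - xs))\<^sup>2 / 2 + L / (2 * \<mu>) * (norm (y - xs))\<^sup>2" (is ?value)
proof -
  define \<alpha> where "\<alpha> = \<mu> / L"
  have \<alpha>: "\<alpha> > 0" "\<alpha> * L = \<mu>"
    using \<mu> L_pos by (auto simp: \<alpha>_def)
  have xs: "xs \<in> X" and min: "composite_obj P F \<phi> xs \<le> composite_obj P F \<phi> z"
    using opt is_prox_D(1)[OF z] unfolding is_arg_min_def by (auto simp: not_less)
  define d D s where "d = (norm (y - xs))\<^sup>2" and "D = (norm (z - xs))\<^sup>2" and "s = (norm (z - y))\<^sup>2"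
  let ?gap = "composite_obj P F \<phi> z - composite_obj P F \<phi> xs"
  have three: "2 * \<alpha> * (\<phi> z - \<phi> xs) \<le> d - s - D - 2 * \<alpha> * (v \<bullet> (z - xs))"
  proof -
    have "\<phi> z - \<phi> xs \<le> 1 / (2 * \<alpha>) *
        ((norm (xs - (y - \<alpha> *\<^sub>R v)))\<^sup>2 - (norm (z - (y - \<alpha> *\<^sub>R v)))\<^sup>2 - (norm (xs - z))\<^sup>2)"
      using prox_three_point[OF \<phi>_convex \<alpha>(1) z[folded \<alpha>_def] xs] by (simp add: algebra_simps)
    then have "2 * \<alpha> * (\<phi> z - \<phi> xs) \<le>
        (norm (xs - (y - \<alpha> *\<^sub>R v)))\<^sup>2 - (norm (z - (y - \<alpha> *\<^sub>R v)))\<^sup>2 - (norm (xs - z))\<^sup>2"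
      using \<alpha>(1) by (simp add: field_simps)
    also have "\<dots> = d - s - D - 2 * \<alpha> * (v \<bullet> (z - xs))"
      unfolding d_def s_def D_def power2_norm_eq_inner
      by (simp add: inner_diff_left inner_diff_right inner_commute algebra_simps)
    finally show ?thesis .
  qed
  have upper: "mean_obj P F z \<le> mean_obj P F y + mean_grad P gF y \<bullet> (z - y) + L / 2 * s"
    unfolding s_def
    by (rule lipschitz_gradient_upper_bound[OF convex_X mean_gradient gradient_lipschitz y is_prox_D(1)[OF z]])
  have lower: "mean_obj P F y + mean_grad P gF y \<bullet> (xs - y) + c / 2 * d \<le> mean_obj P F xs"
    using strongly_convex[OF y xs] by (simp add: d_def norm_minus_commute)
  have v: "v \<bullet> (z - xs) = mean_grad P gF y \<bullet> (z - xs) + e \<bullet> (z - xs)"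
    by (simp add: e_def inner_diff_left)
  have "mean_obj P F z - mean_obj P F xs \<le> mean_grad P gF y \<bullet> (z - xs) + L / 2 * s - c / 2 * d"
    using upper lower by (simp add: inner_diff_right)
  then have "2 * \<alpha> * (mean_obj P F z - mean_obj P F xs) \<le>
      2 * \<alpha> * (mean_grad P gF y \<bullet> (z - xs) + L / 2 * s - c / 2 * d)"
    using \<alpha>(1) by simp
  also have "\<dots> = 2 * \<alpha> * (mean_grad P gF y \<bullet> (z - xs)) + (\<alpha> * L) * s - \<alpha> * c * d"
    by (simp add: algebra_simps)
  finally have key: "2 * \<alpha> * ?gap \<le> (1 - \<alpha> * c) * d - D - (1 - \<mu>) * s - 2 * \<alpha> * (e \<bullet> (z - xs))"
    using three unfolding composite_obj_def v \<alpha>(2) by (simp add: algebra_simps)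
  \<comment> \<open>The part \<open>e \<bullet> (z - y)\<close> depends on the sample through \<open>z\<close>. It is absorbed by the multiple
    \<open>1 - \<mu>\<close> of \<open>s\<close> that is left over in \<open>key\<close>, at the price of a term quadratic in \<open>e\<close>.\<close>
  have young: "- 2 * \<alpha> * (e \<bullet> (z - y)) \<le> (1 - \<mu>) * s + \<alpha>\<^sup>2 / (1 - \<mu>) * (norm e)\<^sup>2"
  proof -
    have "0 \<le> (norm ((1 - \<mu>) *\<^sub>R (z - y) + \<alpha> *\<^sub>R e))\<^sup>2 / (1 - \<mu>)"
      using \<mu> by simp
    also have "\<dots> = ((1 - \<mu>)\<^sup>2 * s + 2 * (1 - \<mu>) * \<alpha> * (e \<bullet> (z - y)) + \<alpha>\<^sup>2 * (norm e)\<^sup>2) / (1 - \<mu>)"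
      unfolding s_def power2_norm_eq_inner
      by (simp add: inner_add_left inner_add_right inner_commute power2_eq_square)
    also have "\<dots> = (1 - \<mu>) * s + 2 * \<alpha> * (e \<bullet> (z - y)) + \<alpha>\<^sup>2 / (1 - \<mu>) * (norm e)\<^sup>2"
      using \<mu> by (simp add: field_simps power2_eq_square)
    finally show ?thesis
      by simp
  qed
  have "0 \<le> 2 * \<alpha> * ?gap"
    using min \<alpha>(1) by simp
  moreover have "e \<bullet> (z - xs) = e \<bullet> (z - y) + e \<bullet> (y - xs)"
    by (simp add: inner_diff_right)
  ultimately have "D \<le> (1 - \<alpha> * c) * d - 2 * \<alpha> * (e \<bullet> (y - xs)) + \<alpha>\<^sup>2 / (1 - \<mu>) * (norm e)\<^sup>2"
    using key young by (simp add: algebra_simps)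
  then show ?contraction
    by (simp add: D_def d_def \<alpha>_def)
  have "- (e \<bullet> (z - xs)) \<le> norm e * norm (z - xs)"
    using norm_cauchy_schwarz[of "- e" "z - xs"] by simp
  also have "\<dots> \<le> (norm e)\<^sup>2 / 2 + D / 2"
    unfolding D_def using sum_squares_bound[of "norm e" "norm (z - xs)"] by simp
  finally have "2 * \<alpha> * - (e \<bullet> (z - xs)) \<le> 2 * \<alpha> * ((norm e)\<^sup>2 / 2 + D / 2)"
    using \<alpha>(1) by (intro mult_left_mono) auto
  moreover have "0 \<le> \<alpha> * c * d" "0 \<le> D" "0 \<le> (1 - \<mu>) * s"
    using \<alpha>(1) c_pos \<mu> by (auto simp: d_def D_def s_def)
  ultimately have "2 * \<alpha> * ?gap \<le> 2 * \<alpha> * ((norm e)\<^sup>2 / 2 + D / 2) + d"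
    using key by (simp add: algebra_simps)
  also have "\<dots> = 2 * \<alpha> * ((norm e)\<^sup>2 / 2 + D / 2 + 1 / (2 * \<alpha>) * d)"
    using \<alpha>(1) by (simp add: field_simps)
  finally have "?gap \<le> (norm e)\<^sup>2 / 2 + D / 2 + 1 / (2 * \<alpha>) * d"
    using \<alpha>(1) by simp
  then show ?value
    by (simp add: D_def d_def \<alpha>_def)
qed

section \<open>Joint measurability of the stochastic gradient\<close>

text \<open>
  A function that is measurable in one variable and continuous in the other is the pointwise limit of
  the functions obtained by rounding the continuous variable to finitely many values.
\<close>

lemma caratheodory_measurable:
  fixes G :: "'a::{metric_space, second_countable_topology} \<Rightarrow> 'b \<Rightarrow> 'c::metric_space"
  assumes meas: "\<And>y. G y \<in> borel_measurable P"
    and cont: "\<And>s. s \<in> space P \<Longrightarrow> continuous_on UNIV (\<lambda>y. G y s)"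
  shows "(\<lambda>(y, s). G y s) \<in> borel_measurable (borel \<Otimes>\<^sub>M P)"
proof -
  obtain q :: "nat \<Rightarrow> 'a \<Rightarrow> 'a" where q: "\<And>i. simple_function borel (q i)"
      "\<And>y. (\<lambda>i. q i y) \<longlonglongrightarrow> y"
    using borel_measurable_implies_sequence_metric[of "\<lambda>y::'a. y" borel undefined]
    by auto
  show ?thesis
  proof (rule borel_measurable_LIMSEQ_metric)
    fix i
    have "(\<lambda>w. (\<lambda>y w. G y (snd w)) (q i (fst w)) w) \<in> borel_measurable (borel \<Otimes>\<^sub>M P)"
    proof (rule measurable_compose_countable'[where f="\<lambda>y w. G y (snd w)"
          and g="\<lambda>w. q i (fst w)" and I="range (q i)"])
      show "(\<lambda>w. G y (snd w)) \<in> borel_measurable (borel \<Otimes>\<^sub>M P)" for y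
        using meas[of y] by measurable
      show "countable (range (q i))"
        using simple_functionD(1)[OF q(1)[of i]] by (simp add: countable_finite)
      have "q i \<in> measurable borel (count_space (range (q i)))"
        using q(1)[of i] by (simp add: measurable_simple_function simple_function_def
            measurable_count_space_eq2)
      then show "(\<lambda>w. q i (fst w)) \<in> measurable (borel \<Otimes>\<^sub>M P) (count_space (range (q i)))"
        by measurable
    qed
    then show "(\<lambda>w. G (q i (fst w)) (snd w)) \<in> borel_measurable (borel \<Otimes>\<^sub>M P)" .
  next
    fix w :: "'a \<times> 'b" assume "w \<in> space (borel \<Otimes>\<^sub>M P)"
    then have "snd w \<in> space P"
      by (auto simp: space_pair_measure)
    from continuous_on_tendsto_compose[OF cont[OF this] q(2)]
    show "(\<lambda>i. G (q i (fst w)) (snd w)) \<longlonglongrightarrow> (\<lambda>(y, s). G y s) w"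
      by (simp add: case_prod_beta)
  qed
qed

text \<open>
  The stochastic gradient is continuous in \<open>x\<close> only for almost every scenario and only on \<open>X\<close>. Setting
  it to zero on the exceptional null set and extending it from \<open>X\<close> by the nearest-point projection gives
  a Caratheodory function. Joint measurability is needed to evaluate the gradient at a random
  iterate and to apply Fubini's theorem.
\<close>

lemma (in composite_problem) gradient_measurable_version:
  obtains G where "(\<lambda>(y, s). G y s) \<in> borel_measurable (borel \<Otimes>\<^sub>M P)"
    and "AE s in P. \<forall>y\<in>X. G y s = gF y s"
proof (cases "X = {}")
  case True
  then show ?thesis
    by (intro that[of "\<lambda>_ _. 0"]) auto
next
  case False
  obtain N where N: "N \<in> null_sets P"
      "\<And>s. s \<in> space P - N \<Longrightarrow> continuous_on X (\<lambda>x. gF x s)"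
    using F_convex_C1 by (auto elim!: AE_E3)
  define G where "G y s = (if s \<in> N then 0 else gF (closest_point X y) s)" for y s
  show ?thesis
  proof (rule that[of G])
    show "(\<lambda>(y, s). G y s) \<in> borel_measurable (borel \<Otimes>\<^sub>M P)"
    proof (rule caratheodory_measurable)
      show "G y \<in> borel_measurable P" for y
      proof -
        have "N \<in> sets P" "gF (closest_point X y) \<in> borel_measurable P"
          using N(1) gF_integrable[OF closest_point_in_set[OF closed_X False, of y]] by auto
        then show ?thesis
          unfolding G_def by measurable
      qed
      show "continuous_on UNIV (\<lambda>y. G y s)" if "s \<in> space P" for s
      proof (cases "s \<in> N")
        case False
        have "continuous_on UNIV (\<lambda>y. gF (closest_point X y) s)"
          using that False
          by (intro continuous_on_compose2[OF N(2) continuous_on_closest_point])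
            (auto simp: convex_X closed_X \<open>X \<noteq> {}\<close> closest_point_in_set)
        with False show ?thesis
          by (simp add: G_def)
      qed (simp add: G_def)
    qed
    show "AE s in P. \<forall>y\<in>X. G y s = gF y s"
      using AE_not_in[OF N(1)] by eventually_elim (auto simp: G_def closest_point_self)
  qed
qed

section \<open>Past and fresh samples\<close>

text \<open>
  Independence is used in one form only: a random variable determined by the samples in \<open>J\<close> is
  independent of every single sample outside \<open>J\<close>. Being determined by the samples in \<open>J\<close> is expressed as
  measurability with respect to the sigma-algebra \<open>past J\<close>, which is stable under all measurable
  operations.
\<close>

locale fresh_samples = prob_space M + P: prob_space P
  for M :: "'w measure" and P :: "'b measure" +
  fixes \<xi> :: "'i \<Rightarrow> 'w \<Rightarrow> 'b" and I :: "'i set"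
  assumes indep: "indep_vars (\<lambda>_. P) \<xi> I"
    and law: "i \<in> I \<Longrightarrow> distr M P (\<xi> i) = P"
begin

definition past :: "'i set \<Rightarrow> 'w measure" where
  "past J = vimage_algebra (space M) (\<lambda>\<omega>. \<lambda>i\<in>J. \<xi> i \<omega>) (PiM J (\<lambda>_. P))"

lemma sample_measurable: "i \<in> I \<Longrightarrow> \<xi> i \<in> measurable M P"
  using indep by (auto simp: indep_vars_def)

lemma samples_measurable: "J \<subseteq> I \<Longrightarrow> (\<lambda>\<omega>. \<lambda>i\<in>J. \<xi> i \<omega>) \<in> measurable M (PiM J (\<lambda>_. P))"
  by (intro measurable_restrict sample_measurable) auto

lemma space_past [simp]: "space (past J) = space M"
  by (simp add: past_def)

lemma past_sample_measurable:
  assumes "J \<subseteq> I" "i \<in> J"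
  shows "\<xi> i \<in> measurable (past J) P"
proof -
  have "(\<lambda>\<omega>. \<lambda>i\<in>J. \<xi> i \<omega>) \<in> measurable (past J) (PiM J (\<lambda>_. P))"
    unfolding past_def using samples_measurable[OF assms(1)]
    by (intro measurable_vimage_algebra1) (auto dest: measurable_space)
  from measurable_compose[OF this measurable_component_singleton[OF assms(2)]] show ?thesis
    using assms(2) by simp
qed

lemma past_mono:
  assumes "J \<subseteq> K" "K \<subseteq> I" and Y: "Y \<in> measurable (past J) N"
  shows "Y \<in> measurable (past K) N"
proof -
  have "(\<lambda>\<omega>. \<omega>) \<in> measurable (past K) (past J)"
    unfolding past_def[of J] using assms samples_measurable[of J]
    by (intro measurable_vimage_algebra2 measurable_restrict past_sample_measurable)
      (auto dest: measurable_space)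
  from measurable_compose[OF this Y] show ?thesis .
qed

lemma past_measurable:
  assumes "J \<subseteq> I" and Y: "Y \<in> measurable (past J) N"
  shows "Y \<in> measurable M N"
proof -
  have "(\<lambda>\<omega>. \<omega>) \<in> measurable M (past J)"
    unfolding past_def using samples_measurable[OF assms(1)]
    by (intro measurable_vimage_algebra2) auto
  from measurable_compose[OF this Y] show ?thesis .
qed

text \<open>
  Stated for events rather than with \<open>indep_var\<close>, which relates random variables of one value type:
  the quantities compared with a fresh sample are vectors or pairs of vectors.
\<close>

lemma past_fresh_product:
  assumes J: "J \<subseteq> I" and k: "k \<in> I - J" and A: "A \<in> sets (past J)" and B: "B \<in> sets P"
  shows "prob (A \<inter> (\<xi> k -` B \<inter> space M)) = prob A * prob (\<xi> k -` B \<inter> space M)"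
proof -
  let ?R = "\<lambda>J \<omega>. \<lambda>i\<in>J. \<xi> i \<omega>" and ?\<Pi> = "\<lambda>J. PiM J (\<lambda>_. P)"
  let ?\<sigma> = "\<lambda>S Z. sigma_sets (space M) {Z -` A \<inter> space M | A. A \<in> sets S}"
  have "indep_var (?\<Pi> J) (?R J) (?\<Pi> {k}) (?R {k})"
    using J k by (intro indep_var_restrict[OF indep]) auto
  then have "indep_set (?\<sigma> (?\<Pi> J) (?R J)) (?\<sigma> (?\<Pi> {k}) (?R {k}))"
    by (simp add: indep_var_eq)
  moreover have "A \<in> ?\<sigma> (?\<Pi> J) (?R J)"
    using A unfolding past_def sets_vimage_algebra by simp
  moreover have "\<xi> k -` B \<inter> space M \<in> ?\<sigma> (?\<Pi> {k}) (?R {k})"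
  proof (rule sigma_sets.Basic, intro CollectI exI conjI)
    show "(\<lambda>f. f k) -` B \<inter> space (?\<Pi> {k}) \<in> sets (?\<Pi> {k})"
      using measurable_sets[OF measurable_component_singleton[of k "{k}" "\<lambda>_. P"] B] by simp
    show "\<xi> k -` B \<inter> space M = ?R {k} -` ((\<lambda>f. f k) -` B \<inter> space (?\<Pi> {k})) \<inter> space M"
      using measurable_space[OF samples_measurable[of "{k}"]] k by auto
  qed
  ultimately show ?thesis
    unfolding indep_sets2_eq by blast
qed

lemma joint_law_past_fresh:
  assumes J: "J \<subseteq> I" and k: "k \<in> I - J" and Y: "Y \<in> measurable (past J) N"
  shows "distr M (N \<Otimes>\<^sub>M P) (\<lambda>\<omega>. (Y \<omega>, \<xi> k \<omega>)) = distr M N Y \<Otimes>\<^sub>M P"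
proof -
  have [measurable]: "Y \<in> measurable M N" "\<xi> k \<in> measurable M P"
    using past_measurable[OF J Y] sample_measurable k by auto
  interpret Y: prob_space "distr M N Y"
    by (rule prob_space_distr) fact
  have "distr M N Y \<Otimes>\<^sub>M P = distr M (N \<Otimes>\<^sub>M P) (\<lambda>\<omega>. (Y \<omega>, \<xi> k \<omega>))"
  proof (rule pair_measure_eqI)
    fix A B assume A: "A \<in> sets (distr M N Y)" and B: "B \<in> sets P"
    have "emeasure P B = emeasure (distr M P (\<xi> k)) B"
      using law[of k] k by simp
    then have "emeasure (distr M N Y) A * emeasure P B =
        ennreal (prob (Y -` A \<inter> space M) * prob (\<xi> k -` B \<inter> space M))"
      using A B by (simp add: emeasure_distr emeasure_eq_measure ennreal_mult)
    also have "\<dots> = ennreal (prob ((Y -` A \<inter> space M) \<inter> (\<xi> k -` B \<inter> space M)))"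
      using measurable_sets[OF Y, of A] A B by (subst past_fresh_product[OF J k]) auto
    also have "(Y -` A \<inter> space M) \<inter> (\<xi> k -` B \<inter> space M) =
        (\<lambda>\<omega>. (Y \<omega>, \<xi> k \<omega>)) -` (A \<times> B) \<inter> space M"
      by auto
    also have "ennreal (prob \<dots>) = emeasure (distr M (N \<Otimes>\<^sub>M P) (\<lambda>\<omega>. (Y \<omega>, \<xi> k \<omega>))) (A \<times> B)"
      using A B by (simp add: emeasure_distr emeasure_eq_measure)
    finally show "emeasure (distr M N Y) A * emeasure P B =
        emeasure (distr M (N \<Otimes>\<^sub>M P) (\<lambda>\<omega>. (Y \<omega>, \<xi> k \<omega>))) (A \<times> B)" .
  qed (auto intro: Y.sigma_finite_measure_axioms P.sigma_finite_measure_axioms)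
  then show ?thesis ..
qed

lemma nn_integral_past_fresh:
  assumes J: "J \<subseteq> I" and k: "k \<in> I - J" and Y: "Y \<in> measurable (past J) N"
    and h: "h \<in> borel_measurable (N \<Otimes>\<^sub>M P)"
  shows "(\<integral>\<^sup>+\<omega>. h (Y \<omega>, \<xi> k \<omega>) \<partial>M) = (\<integral>\<^sup>+\<omega>. (\<integral>\<^sup>+s. h (Y \<omega>, s) \<partial>P) \<partial>M)"
proof -
  have Y': "Y \<in> measurable M N" and k': "\<xi> k \<in> measurable M P"
    using past_measurable[OF J Y] sample_measurable k by auto
  interpret Y: prob_space "distr M N Y"
    by (rule prob_space_distr) fact
  have "(\<integral>\<^sup>+\<omega>. h (Y \<omega>, \<xi> k \<omega>) \<partial>M) = (\<integral>\<^sup>+w. h w \<partial>distr M (N \<Otimes>\<^sub>M P) (\<lambda>\<omega>. (Y \<omega>, \<xi> k \<omega>)))"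
    using Y' k' h by (subst nn_integral_distr) auto
  also have "\<dots> = (\<integral>\<^sup>+y. (\<integral>\<^sup>+s. h (y, s) \<partial>P) \<partial>distr M N Y)"
    unfolding joint_law_past_fresh[OF J k Y] using h by (subst P.nn_integral_fst[symmetric]) auto
  also have "\<dots> = (\<integral>\<^sup>+\<omega>. (\<integral>\<^sup>+s. h (Y \<omega>, s) \<partial>P) \<partial>M)"
    using Y' h by (subst nn_integral_distr) auto
  finally show ?thesis .
qed

lemma integral_past_fresh:
  fixes h :: "_ \<Rightarrow> real"
  assumes J: "J \<subseteq> I" and k: "k \<in> I - J" and Y: "Y \<in> measurable (past J) N"
    and h: "h \<in> borel_measurable (N \<Otimes>\<^sub>M P)"
    and int: "integrable M (\<lambda>\<omega>. h (Y \<omega>, \<xi> k \<omega>))"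
  shows "(\<integral>\<omega>. h (Y \<omega>, \<xi> k \<omega>) \<partial>M) = (\<integral>\<omega>. (\<integral>s. h (Y \<omega>, s) \<partial>P) \<partial>M)"
proof -
  have Y': "Y \<in> measurable M N" and k': "\<xi> k \<in> measurable M P"
    using past_measurable[OF J Y] sample_measurable k by auto
  interpret Y: prob_space "distr M N Y"
    by (rule prob_space_distr) fact
  interpret YP: pair_prob_space "distr M N Y" P ..
  have "integrable (distr M N Y \<Otimes>\<^sub>M P) h"
    unfolding joint_law_past_fresh[OF J k Y, symmetric] using int Y' k' h
    by (subst integrable_distr_eq) auto
  note fub = YP.integral_fst'[OF this]
  have "(\<integral>\<omega>. h (Y \<omega>, \<xi> k \<omega>) \<partial>M) = (\<integral>w. h w \<partial>distr M (N \<Otimes>\<^sub>M P) (\<lambda>\<omega>. (Y \<omega>, \<xi> k \<omega>)))"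
    using Y' k' h by (subst integral_distr) auto
  also have "\<dots> = (\<integral>y. (\<integral>s. h (y, s) \<partial>P) \<partial>distr M N Y)"
    unfolding joint_law_past_fresh[OF J k Y] fub ..
  also have "\<dots> = (\<integral>\<omega>. (\<integral>s. h (Y \<omega>, s) \<partial>P) \<partial>M)"
    using Y' h by (subst integral_distr) auto
  finally show ?thesis .
qed

end

section \<open>Noise of a batch\<close>

lemma integrable_inner_of_squares:
  fixes Z B :: "'w \<Rightarrow> 'a::euclidean_space"
  assumes [measurable]: "Z \<in> borel_measurable M" "B \<in> borel_measurable M"
    and int: "integrable M (\<lambda>\<omega>. (norm (Z \<omega>))\<^sup>2)" "integrable M (\<lambda>\<omega>. (norm (B \<omega>))\<^sup>2)"
  shows "integrable M (\<lambda>\<omega>. Z \<omega> \<bullet> B \<omega>)"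
proof (rule Bochner_Integration.integrable_bound)
  show "integrable M (\<lambda>\<omega>. (norm (Z \<omega>))\<^sup>2 + (norm (B \<omega>))\<^sup>2)"
    using int by simp
  show "AE \<omega> in M. norm (Z \<omega> \<bullet> B \<omega>) \<le> norm ((norm (Z \<omega>))\<^sup>2 + (norm (B \<omega>))\<^sup>2)"
  proof (intro AE_I2)
    fix \<omega>
    have "\<bar>Z \<omega> \<bullet> B \<omega>\<bar> \<le> norm (Z \<omega>) * norm (B \<omega>)"
      by (rule Cauchy_Schwarz_ineq2)
    also have "\<dots> \<le> 2 * norm (Z \<omega>) * norm (B \<omega>)"
      by simp
    also have "\<dots> \<le> (norm (Z \<omega>))\<^sup>2 + (norm (B \<omega>))\<^sup>2"
      by (rule sum_squares_bound)
    finally show "norm (Z \<omega> \<bullet> B \<omega>) \<le> norm ((norm (Z \<omega>))\<^sup>2 + (norm (B \<omega>))\<^sup>2)"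
      by simp
  qed
qed measurable

text \<open>
  The batch estimates use only the first two moments of the oracle, so they are kept apart from the
  optimisation problem. The bound on the variance involves a single reference point, because the
  distance to the solution is the only quantity that the recursion for the iterates controls.
\<close>

locale noisy_oracle = fresh_samples M P \<xi> I
  for M :: "'w measure" and P :: "'b measure" and \<xi> :: "'i \<Rightarrow> 'w \<Rightarrow> 'b" and I +
  fixes X :: "'a::euclidean_space set" and G :: "'a \<Rightarrow> 'b \<Rightarrow> 'a" and m :: "'a \<Rightarrow> 'a"
    and xs :: 'a and a b :: real
  assumes G_measurable: "(\<lambda>(y, s). G y s) \<in> borel_measurable (borel \<Otimes>\<^sub>M P)"
    and G_integrable: "y \<in> X \<Longrightarrow> integrable P (G y)"
    and G_mean: "y \<in> X \<Longrightarrow> (\<integral>s. G y s \<partial>P) = m y"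
    and G_square_integrable: "y \<in> X \<Longrightarrow> integrable P (\<lambda>s. (norm (G y s - m y))\<^sup>2)"
    and G_variance: "y \<in> X \<Longrightarrow> (\<integral>s. (norm (G y s - m y))\<^sup>2 \<partial>P) \<le> a + b * (norm (y - xs))\<^sup>2"
begin

text \<open>
  The noise is centred at the integral of \<open>G y\<close>, also outside \<open>X\<close>, because this makes it jointly
  measurable without any assumption on \<open>m\<close>; on \<open>X\<close> both centres agree.
\<close>

definition noise :: "'a \<Rightarrow> 'b \<Rightarrow> 'a" where
  "noise y s = G y s - (\<integral>s. G y s \<partial>P)"

lemma noise_measurable [measurable]: "(\<lambda>(y, s). noise y s) \<in> borel_measurable (borel \<Otimes>\<^sub>M P)"
proof -
  note G_measurable [measurable]
  have "(\<lambda>y. \<integral>s. G y s \<partial>P) \<in> borel_measurable borel"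
    using P.borel_measurable_lebesgue_integral[OF G_measurable] by simp
  then have [measurable]: "(\<lambda>(y, s). \<integral>s. G y s \<partial>P) \<in> borel_measurable (borel \<Otimes>\<^sub>M P)"
    unfolding case_prod_beta by (rule measurable_compose[OF measurable_fst])
  have "(\<lambda>w. (\<lambda>(y, s). G y s) w - (\<lambda>(y, s). \<integral>s. G y s \<partial>P) w) \<in> borel_measurable (borel \<Otimes>\<^sub>M P)"
    by (rule borel_measurable_diff) measurable
  then show ?thesis
    by (simp add: noise_def case_prod_beta)
qed

lemma noise_eq: "y \<in> X \<Longrightarrow> noise y s = G y s - m y"
  by (simp add: noise_def G_mean)

lemma noise_compose_measurable [measurable (raw)]:
  assumes "Y \<in> borel_measurable N" "Z \<in> measurable N P"
  shows "(\<lambda>\<omega>. noise (Y \<omega>) (Z \<omega>)) \<in> borel_measurable N"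
  using measurable_compose[OF measurable_Pair[OF assms] noise_measurable] by simp

lemma fresh_noise_second_moment:
  assumes J: "J \<subseteq> I" and k: "k \<in> I - J" and Y: "Y \<in> borel_measurable (past J)"
    and YX: "\<And>\<omega>. \<omega> \<in> space M \<Longrightarrow> Y \<omega> \<in> X"
    and int: "integrable M (\<lambda>\<omega>. (norm (Y \<omega> - xs))\<^sup>2)"
  shows "integrable M (\<lambda>\<omega>. (norm (noise (Y \<omega>) (\<xi> k \<omega>)))\<^sup>2)"
    and "(\<integral>\<omega>. (norm (noise (Y \<omega>) (\<xi> k \<omega>)))\<^sup>2 \<partial>M) \<le> a + b * (\<integral>\<omega>. (norm (Y \<omega> - xs))\<^sup>2 \<partial>M)"
proof -
  have [measurable]: "Y \<in> borel_measurable M" "\<xi> k \<in> measurable M P"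
    using past_measurable[OF J Y] sample_measurable k by auto
  have bound0: "0 \<le> a + b * (norm (Y \<omega> - xs))\<^sup>2" if "\<omega> \<in> space M" for \<omega>
    using order_trans[OF _ G_variance[OF YX[OF that]]] by simp
  have le: "(\<integral>\<^sup>+\<omega>. ennreal ((norm (noise (Y \<omega>) (\<xi> k \<omega>)))\<^sup>2) \<partial>M)
      \<le> ennreal (\<integral>\<omega>. a + b * (norm (Y \<omega> - xs))\<^sup>2 \<partial>M)"
  proof -
    have "(\<integral>\<^sup>+\<omega>. ennreal ((norm (noise (Y \<omega>) (\<xi> k \<omega>)))\<^sup>2) \<partial>M) =
        (\<integral>\<^sup>+\<omega>. (\<integral>\<^sup>+s. ennreal ((norm (noise (Y \<omega>) s))\<^sup>2) \<partial>P) \<partial>M)"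
      using nn_integral_past_fresh[OF J k Y, of "\<lambda>(y, s). ennreal ((norm (noise y s))\<^sup>2)"] by simp
    also have "\<dots> \<le> (\<integral>\<^sup>+\<omega>. ennreal (a + b * (norm (Y \<omega> - xs))\<^sup>2) \<partial>M)"
    proof (rule nn_integral_mono)
      fix \<omega> assume "\<omega> \<in> space M"
      note YX = YX[OF this]
      have "(\<integral>\<^sup>+s. ennreal ((norm (noise (Y \<omega>) s))\<^sup>2) \<partial>P) =
          ennreal (\<integral>s. (norm (G (Y \<omega>) s - m (Y \<omega>)))\<^sup>2 \<partial>P)"
        unfolding noise_eq[OF YX] using G_square_integrable[OF YX]
        by (intro nn_integral_eq_integral) auto
      also have "\<dots> \<le> ennreal (a + b * (norm (Y \<omega> - xs))\<^sup>2)"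
        by (intro ennreal_leI G_variance YX)
      finally show "(\<integral>\<^sup>+s. ennreal ((norm (noise (Y \<omega>) s))\<^sup>2) \<partial>P) \<le>
        ennreal (a + b * (norm (Y \<omega> - xs))\<^sup>2)" .
    qed
    also have "\<dots> = ennreal (\<integral>\<omega>. a + b * (norm (Y \<omega> - xs))\<^sup>2 \<partial>M)"
      using int bound0 by (intro nn_integral_eq_integral) auto
    finally show ?thesis .
  qed
  show int': "integrable M (\<lambda>\<omega>. (norm (noise (Y \<omega>) (\<xi> k \<omega>)))\<^sup>2)"
  proof (rule integrableI_nonneg)
    show "(\<integral>\<^sup>+\<omega>. ennreal ((norm (noise (Y \<omega>) (\<xi> k \<omega>)))\<^sup>2) \<partial>M) < \<infinity>"
      using le by (rule order.strict_trans1) simp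
  qed auto
  have "ennreal (\<integral>\<omega>. (norm (noise (Y \<omega>) (\<xi> k \<omega>)))\<^sup>2 \<partial>M) \<le>
      ennreal (\<integral>\<omega>. a + b * (norm (Y \<omega> - xs))\<^sup>2 \<partial>M)"
    using le nn_integral_eq_integral[OF int'] by simp
  then have "(\<integral>\<omega>. (norm (noise (Y \<omega>) (\<xi> k \<omega>)))\<^sup>2 \<partial>M) \<le> (\<integral>\<omega>. a + b * (norm (Y \<omega> - xs))\<^sup>2 \<partial>M)"
    using bound0 by (subst (asm) ennreal_le_iff) (auto intro!: Bochner_Integration.integral_nonneg_AE)
  then show "(\<integral>\<omega>. (norm (noise (Y \<omega>) (\<xi> k \<omega>)))\<^sup>2 \<partial>M) \<le> a + b * (\<integral>\<omega>. (norm (Y \<omega> - xs))\<^sup>2 \<partial>M)"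
    using int by (simp add: prob_space)
qed

text \<open>
  Conditionally on the past, \<open>Y\<close> and \<open>B\<close> are constants and the noise of a fresh sample has mean zero.
  Two choices of \<open>B\<close> matter: the distance vector \<open>Y - xs\<close>, and the noise accumulated from the earlier
  samples of the same batch.
\<close>

lemma fresh_noise_uncorrelated:
  assumes J: "J \<subseteq> I" and k: "k \<in> I - J" and Y: "Y \<in> borel_measurable (past J)"
    and YX: "\<And>\<omega>. \<omega> \<in> space M \<Longrightarrow> Y \<omega> \<in> X"
    and int: "integrable M (\<lambda>\<omega>. (norm (Y \<omega> - xs))\<^sup>2)"
    and B: "B \<in> borel_measurable (past J)" and intB: "integrable M (\<lambda>\<omega>. (norm (B \<omega>))\<^sup>2)"
  shows "integrable M (\<lambda>\<omega>. noise (Y \<omega>) (\<xi> k \<omega>) \<bullet> B \<omega>)"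
    and "(\<integral>\<omega>. noise (Y \<omega>) (\<xi> k \<omega>) \<bullet> B \<omega> \<partial>M) = 0"
proof -
  have [measurable]: "Y \<in> borel_measurable M" "B \<in> borel_measurable M" "\<xi> k \<in> measurable M P"
    using past_measurable[OF J] Y B sample_measurable k by auto
  show int': "integrable M (\<lambda>\<omega>. noise (Y \<omega>) (\<xi> k \<omega>) \<bullet> B \<omega>)"
    using fresh_noise_second_moment(1)[OF J k Y YX int] intB
    by (intro integrable_inner_of_squares) auto
  let ?h = "\<lambda>((y, \<beta>), s). noise y s \<bullet> \<beta>"
  have YB: "(\<lambda>\<omega>. (Y \<omega>, B \<omega>)) \<in> measurable (past J) (borel \<Otimes>\<^sub>M borel)"
    using Y B by measurable
  have "(\<integral>\<omega>. ?h ((Y \<omega>, B \<omega>), \<xi> k \<omega>) \<partial>M) = (\<integral>\<omega>. (\<integral>s. ?h ((Y \<omega>, B \<omega>), s) \<partial>P) \<partial>M)"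
    using int' by (intro integral_past_fresh[OF J k YB]) (simp_all add: case_prod_beta)
  also have "\<dots> = (\<integral>\<omega>. 0 \<partial>M)"
  proof (intro Bochner_Integration.integral_cong refl)
    fix \<omega> assume "\<omega> \<in> space M"
    note YX = YX[OF this]
    show "(\<integral>s. ?h ((Y \<omega>, B \<omega>), s) \<partial>P) = 0"
      using G_integrable[OF YX] by (simp add: noise_eq[OF YX] G_mean[OF YX] P.prob_space)
  qed
  finally show "(\<integral>\<omega>. noise (Y \<omega>) (\<xi> k \<omega>) \<bullet> B \<omega> \<partial>M) = 0"
    by simp
qed

text \<open>
  The variance of a batch is additive: by induction on \<open>n\<close>, the noise of sample \<open>k n\<close> is
  uncorrelated with the sum of the noises before it, so the cross term in the square of the sum
  vanishes. The samples already drawn from the batch are added to the past one at a time.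
\<close>

lemma batch_noise:
  fixes k :: "nat \<Rightarrow> 'i"
  assumes J: "\<And>j. J j = J 0 \<union> k ` {1..j}" and JI: "J n \<subseteq> I"
    and fresh: "k ` {1..n} \<inter> J 0 = {}" and inj: "inj_on k {1..n}"
    and Y: "Y \<in> borel_measurable (past (J 0))"
    and YX: "\<And>\<omega>. \<omega> \<in> space M \<Longrightarrow> Y \<omega> \<in> X"
    and int: "integrable M (\<lambda>\<omega>. (norm (Y \<omega> - xs))\<^sup>2)"
  defines "S \<equiv> \<lambda>n \<omega>. \<Sum>j=1..n. noise (Y \<omega>) (\<xi> (k j) \<omega>)"
  shows "S n \<in> borel_measurable (past (J n))"
    and "integrable M (\<lambda>\<omega>. (norm (S n \<omega>))\<^sup>2)"
    and "(\<integral>\<omega>. (norm (S n \<omega>))\<^sup>2 \<partial>M) \<le> real n * (a + b * (\<integral>\<omega>. (norm (Y \<omega> - xs))\<^sup>2 \<partial>M))"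
    and "integrable M (\<lambda>\<omega>. S n \<omega> \<bullet> (Y \<omega> - xs))"
    and "(\<integral>\<omega>. S n \<omega> \<bullet> (Y \<omega> - xs) \<partial>M) = 0"
proof -
  have "S n \<in> borel_measurable (past (J n)) \<and> integrable M (\<lambda>\<omega>. (norm (S n \<omega>))\<^sup>2) \<and>
    (\<integral>\<omega>. (norm (S n \<omega>))\<^sup>2 \<partial>M) \<le> real n * (a + b * (\<integral>\<omega>. (norm (Y \<omega> - xs))\<^sup>2 \<partial>M)) \<and>
    integrable M (\<lambda>\<omega>. S n \<omega> \<bullet> (Y \<omega> - xs)) \<and> (\<integral>\<omega>. S n \<omega> \<bullet> (Y \<omega> - xs) \<partial>M) = 0"
    using JI fresh inj
  proof (induction n)
    case 0
    show ?case
      by (simp add: S_def)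
  next
    case (Suc n)
    have sub: "J n \<subseteq> J (Suc n)" "J 0 \<subseteq> J n"
      by (subst (1 2) J; auto)+
    have pre: "J n \<subseteq> I" "k ` {1..n} \<inter> J 0 = {}" "inj_on k {1..n}"
      using sub Suc.prems inj_on_subset[OF Suc.prems(3), of "{1..n}"] by fastforce+
    have IH: "S n \<in> borel_measurable (past (J n))" "integrable M (\<lambda>\<omega>. (norm (S n \<omega>))\<^sup>2)"
      "(\<integral>\<omega>. (norm (S n \<omega>))\<^sup>2 \<partial>M) \<le> real n * (a + b * (\<integral>\<omega>. (norm (Y \<omega> - xs))\<^sup>2 \<partial>M))"
      "integrable M (\<lambda>\<omega>. S n \<omega> \<bullet> (Y \<omega> - xs))" "(\<integral>\<omega>. S n \<omega> \<bullet> (Y \<omega> - xs) \<partial>M) = 0"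
      using Suc.IH[OF pre] by blast+
    define \<delta> where "\<delta> \<omega> = noise (Y \<omega>) (\<xi> (k (Suc n)) \<omega>)" for \<omega>
    have JnI: "J n \<subseteq> I" "J (Suc n) \<subseteq> I"
      using sub Suc.prems by auto
    have "k (Suc n) \<in> J (Suc n)"
      by (subst J) auto
    moreover have "k (Suc n) \<notin> J n"
      using Suc.prems(2) inj_onD[OF Suc.prems(3), of "Suc n"] by (subst J) force
    ultimately have kI: "k (Suc n) \<in> I - J n"
      using JnI by auto
    have Yn: "Y \<in> borel_measurable (past (J n))"
      using sub JnI by (intro past_mono[OF _ _ Y])
    have Yb: "(\<lambda>\<omega>. Y \<omega> - xs) \<in> borel_measurable (past (J n))"
      using Yn by measurable
    note \<delta>2 = fresh_noise_second_moment[OF JnI(1) kI Yn YX int, folded \<delta>_def]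
    note \<delta>Y = fresh_noise_uncorrelated[OF JnI(1) kI Yn YX int Yb int, folded \<delta>_def]
    note \<delta>S = fresh_noise_uncorrelated[OF JnI(1) kI Yn YX int IH(1,2), folded \<delta>_def]
    have SSuc: "S (Suc n) \<omega> = S n \<omega> + \<delta> \<omega>" for \<omega>
      by (simp add: S_def \<delta>_def)
    have "\<delta> \<in> borel_measurable (past (J (Suc n)))"
      unfolding \<delta>_def using past_mono[OF sub(1) JnI(2) Yn]
        past_sample_measurable[OF JnI(2) \<open>k (Suc n) \<in> J (Suc n)\<close>]
      by (rule noise_compose_measurable)
    moreover have "S n \<in> borel_measurable (past (J (Suc n)))"
      using past_mono[OF sub(1) JnI(2) IH(1)] .
    ultimately have meas: "S (Suc n) \<in> borel_measurable (past (J (Suc n)))"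
      unfolding SSuc[abs_def] by measurable
    have sq: "(norm (S (Suc n) \<omega>))\<^sup>2 = (norm (S n \<omega>))\<^sup>2 + 2 * (\<delta> \<omega> \<bullet> S n \<omega>) + (norm (\<delta> \<omega>))\<^sup>2" for \<omega>
      unfolding SSuc power2_norm_eq_inner by (simp add: inner_add_left inner_add_right inner_commute)
    have ySuc: "S (Suc n) \<omega> \<bullet> (Y \<omega> - xs) = S n \<omega> \<bullet> (Y \<omega> - xs) + \<delta> \<omega> \<bullet> (Y \<omega> - xs)" for \<omega>
      by (simp add: SSuc inner_add_left)
    show ?case
      unfolding sq ySuc using meas IH \<delta>2 \<delta>S \<delta>Y
      by (simp add: ring_distribs)
  qed
  then show "S n \<in> borel_measurable (past (J n))"
    and "integrable M (\<lambda>\<omega>. (norm (S n \<omega>))\<^sup>2)"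
    and "(\<integral>\<omega>. (norm (S n \<omega>))\<^sup>2 \<partial>M) \<le> real n * (a + b * (\<integral>\<omega>. (norm (Y \<omega> - xs))\<^sup>2 \<partial>M))"
    and "integrable M (\<lambda>\<omega>. S n \<omega> \<bullet> (Y \<omega> - xs))"
    and "(\<integral>\<omega>. S n \<omega> \<bullet> (Y \<omega> - xs) \<partial>M) = 0"
    by blast+
qed

end

section \<open>The expected effect of one iteration\<close>

text \<open>
  The Lipschitz bound on the standard deviation propagates finiteness from one point to all of \<open>X\<close>;
  squaring it gives growth at most quadratic in the distance to \<open>xs\<close>.
\<close>

lemma (in composite_problem) noise_variance_growth:
  assumes noise: "multiplicative_noise X P gF \<sigma>L" and xs: "xs \<in> X"
  obtains a b where "0 \<le> a" "0 \<le> b"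
    and "\<And>y. y \<in> X \<Longrightarrow> integrable P (\<lambda>s. (norm (gF y s - mean_grad P gF y))\<^sup>2)"
    and "\<And>y. y \<in> X \<Longrightarrow>
      (\<integral>s. (norm (gF y s - mean_grad P gF y))\<^sup>2 \<partial>P) \<le> a + b * (norm (y - xs))\<^sup>2"
proof -
  define V where "V y = (\<integral>s. (norm (gF y s - mean_grad P gF y))\<^sup>2 \<partial>P)" for y
  obtain x0 where x0: "x0 \<in> X" "noise_sd P gF x0 < \<infinity>" and "\<sigma>L > 0"
    and lip: "\<And>y z. y \<in> X \<Longrightarrow> z \<in> X \<Longrightarrow>
      noise_sd P gF y \<le> noise_sd P gF z + ennreal (\<sigma>L * norm (y - z))"
    using noise unfolding multiplicative_noise_def by auto
  have finite: "noise_sd P gF y < \<infinity>" if "y \<in> X" for y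
  proof (rule le_less_trans[OF lip[OF that x0(1)]])
    show "noise_sd P gF x0 + ennreal (\<sigma>L * norm (y - x0)) < \<infinity>"
      using x0(2) by (simp add: less_top[symmetric])
  qed
  have int: "integrable P (\<lambda>s. (norm (gF y s - mean_grad P gF y))\<^sup>2)" if "y \<in> X" for y
    using finite[OF that] unfolding noise_sd_def by (auto split: if_splits)
  have sd: "noise_sd P gF y = ennreal (sqrt (V y))" if "y \<in> X" for y
    using int[OF that] by (simp add: noise_sd_def V_def)
  have V0: "0 \<le> V y" for y
    unfolding V_def by (intro Bochner_Integration.integral_nonneg) auto
  have "V y \<le> 2 * V xs + 2 * \<sigma>L\<^sup>2 * (norm (y - xs))\<^sup>2" if y: "y \<in> X" for y
  proof -
    have "ennreal (sqrt (V y)) \<le> ennreal (sqrt (V xs) + \<sigma>L * norm (y - xs))"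
      using lip[OF y xs] \<open>\<sigma>L > 0\<close> V0 by (simp add: sd y xs)
    then have "sqrt (V y) \<le> sqrt (V xs) + \<sigma>L * norm (y - xs)"
      using \<open>\<sigma>L > 0\<close> V0 by (subst (asm) ennreal_le_iff) auto
    then have "(sqrt (V y))\<^sup>2 \<le> (sqrt (V xs) + \<sigma>L * norm (y - xs))\<^sup>2"
      using V0 by (intro power_mono) auto
    also have "\<dots> \<le> 2 * (sqrt (V xs))\<^sup>2 + 2 * (\<sigma>L * norm (y - xs))\<^sup>2"
      using sum_squares_bound[of "sqrt (V xs)" "\<sigma>L * norm (y - xs)"] by (simp add: power2_sum)
    finally show ?thesis
      using V0 by (simp add: power_mult_distrib)
  qed
  then show ?thesis
    using V0 int by (intro that[of "2 * V xs" "2 * \<sigma>L\<^sup>2"]) (auto simp: V_def)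
qed

text \<open>
  The iterates as an explicit function of the samples \<open>s\<close>, numbered from 0. Measurability with respect
  to the past samples can only be read off from such an explicit form: measurability of \<open>x t\<close>
  on the whole probability space does not imply it.
\<close>

primrec prox_iterates ::
  "('a \<Rightarrow> 'a) \<Rightarrow> real \<Rightarrow> ('a::euclidean_space \<Rightarrow> 'b \<Rightarrow> 'a) \<Rightarrow> (nat \<Rightarrow> nat) \<Rightarrow> (nat \<Rightarrow> nat \<Rightarrow> 'b)
    \<Rightarrow> 'a \<Rightarrow> nat \<Rightarrow> 'a" where
  "prox_iterates p \<alpha> G N s x1 0 = x1"
| "prox_iterates p \<alpha> G N s x1 (Suc n) =
    p (prox_iterates p \<alpha> G N s x1 n
      - \<alpha> *\<^sub>R batch_grad G (N (Suc n)) (s (Suc n)) (prox_iterates p \<alpha> G N s x1 n))"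

lemma (in composite_problem) mean_obj_continuous: "continuous_on X (mean_obj P F)"
  using mean_gradient unfolding has_gradient_on_def
  by (meson continuous_on_eq_continuous_within has_derivative_continuous)

text \<open>
  Every point \<open>u\<close> arises as \<open>y - \<alpha> v\<close> from a given \<open>y \<in> X\<close> and a suitable \<open>v\<close>, so the proximal map is
  defined on the whole space.
\<close>

lemma (in composite_problem) prox_exists:
  assumes "X \<noteq> {}" "\<alpha> > 0"
  shows "\<exists>z. is_prox X \<phi> \<alpha> u z"
proof -
  obtain y where y: "y \<in> X"
    using assms(1) by blast
  have "y - \<alpha> *\<^sub>R ((1 / \<alpha>) *\<^sub>R (y - u)) = u"
    using assms(2) by simp
  then show ?thesis
    using prox_well_defined[OF assms(2) y, of "(1 / \<alpha>) *\<^sub>R (y - u)"]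
    unfolding is_arg_min_prox_obj_iff[OF assms(2)] by auto
qed

text \<open>
  Expectation of the pointwise step bounds. The algorithm is first replaced by the iterates \<open>y\<close> driven by
  the jointly measurable gradient \<open>G\<close>; they are measurable with respect to the past samples and coincide
  almost surely with \<open>x\<close>. For \<open>y\<close>, the linear error term has mean zero and the quadratic one has the
  variance of a batch average; square integrability is carried along by induction.
\<close>

lemma (in composite_problem) expected_step:
  fixes M :: "'w measure" and x :: "nat \<Rightarrow> 'w \<Rightarrow> 'a" and xs :: 'a
  assumes noise: "multiplicative_noise X P gF \<sigma>L"
    and \<mu>: "0 < \<mu>" "\<mu> < 1" and M: "prob_space M"
    and N: "\<And>t. 1 \<le> t \<Longrightarrow> 1 \<le> N t"
    and alg: "stochastic_prox_gradient M X P F gF \<phi> (\<lambda>_. \<mu> / L) N \<xi> x1 x"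
    and opt: "is_arg_min (composite_obj P F \<phi>) (\<lambda>z. z \<in> X) xs"
  obtains a b where "0 \<le> a" "0 \<le> b"
    and "\<And>t. 1 \<le> t \<Longrightarrow> integrable M (\<lambda>\<omega>. (norm (x t \<omega> - xs))\<^sup>2)"
    and "\<And>t. 1 \<le> t \<Longrightarrow> (\<integral>\<omega>. (norm (x (Suc t) \<omega> - xs))\<^sup>2 \<partial>M) \<le>
      (1 - \<mu> * c / L) * (\<integral>\<omega>. (norm (x t \<omega> - xs))\<^sup>2 \<partial>M)
      + (\<mu> / L)\<^sup>2 / (1 - \<mu>) * ((a + b * (\<integral>\<omega>. (norm (x t \<omega> - xs))\<^sup>2 \<partial>M)) / real (N t))"
    and "\<And>t. 1 \<le> t \<Longrightarrow>
      expectation_le M (\<lambda>\<omega>. composite_obj P F \<phi> (x (Suc t) \<omega>) - composite_obj P F \<phi> xs)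
        ((a + b * (\<integral>\<omega>. (norm (x t \<omega> - xs))\<^sup>2 \<partial>M)) / real (N t) / 2
          + (\<integral>\<omega>. (norm (x (Suc t) \<omega> - xs))\<^sup>2 \<partial>M) / 2
          + L / (2 * \<mu>) * (\<integral>\<omega>. (norm (x t \<omega> - xs))\<^sup>2 \<partial>M))"
proof -
  interpret M: prob_space M by fact
  interpret P: prob_space P by (rule prob_P)
  define \<alpha> where "\<alpha> = \<mu> / L"
  have \<alpha>: "\<alpha> > 0"
    using \<mu> L_pos by (simp add: \<alpha>_def)
  have xs: "xs \<in> X"
    using opt by (simp add: is_arg_min_def)
  have x1: "x1 \<in> X" and x_meas [measurable]: "\<And>t. 1 \<le> t \<Longrightarrow> x t \<in> borel_measurable M"
    and x_init: "\<And>\<omega>. \<omega> \<in> space M \<Longrightarrow> x 1 \<omega> = x1"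
    and x_step: "\<And>t \<omega>. 1 \<le> t \<Longrightarrow> \<omega> \<in> space M \<Longrightarrow> is_prox X \<phi> \<alpha>
       (x t \<omega> - \<alpha> *\<^sub>R batch_grad gF (N t) (\<lambda>j. \<xi> t j \<omega>) (x t \<omega>)) (x (Suc t) \<omega>)"
    using alg \<alpha> unfolding stochastic_prox_gradient_def \<alpha>_def[symmetric]
    by (auto simp: is_arg_min_prox_obj_iff)
  have x_in: "x t \<omega> \<in> X" if "1 \<le> t" "\<omega> \<in> space M" for t \<omega>
    using that x_init[of \<omega>] x1 is_prox_D(1)[OF x_step[of "t - 1" \<omega>]]
    by (cases "t = 1") auto

  define I where "I = {(t, j). 1 \<le> t \<and> 1 \<le> j \<and> j \<le> N t}"
  define smp where "smp = (\<lambda>(t, j). \<xi> t j)"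
  obtain a b where ab: "0 \<le> a" "0 \<le> b"
    and var: "\<And>y. y \<in> X \<Longrightarrow> integrable P (\<lambda>s. (norm (gF y s - mean_grad P gF y))\<^sup>2)"
      "\<And>y. y \<in> X \<Longrightarrow>
        (\<integral>s. (norm (gF y s - mean_grad P gF y))\<^sup>2 \<partial>P) \<le> a + b * (norm (y - xs))\<^sup>2"
    using noise_variance_growth[OF noise xs] by blast
  obtain G where G: "(\<lambda>(y, s). G y s) \<in> borel_measurable (borel \<Otimes>\<^sub>M P)"
    and G_eq: "AE s in P. \<forall>y\<in>X. G y s = gF y s"
    by (rule gradient_measurable_version)
  have G_meas: "G y \<in> borel_measurable P" for y
    using measurable_compose[OF measurable_Pair1' G, of y] by simp
  have G_eq': "AE s in P. G y s = gF y s" if "y \<in> X" for y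
    using G_eq by eventually_elim (use that in auto)
  interpret noisy_oracle M P smp I X G "mean_grad P gF" xs a b
  proof
    show "distr M P (smp i) = P" if "i \<in> I" for i
      using alg that
      unfolding stochastic_prox_gradient_def iid_samples_def I_def smp_def by auto
    show "M.indep_vars (\<lambda>_. P) smp I"
      using alg unfolding stochastic_prox_gradient_def iid_samples_def I_def smp_def by auto
    fix y assume y: "y \<in> X"
    have [measurable]: "gF y \<in> borel_measurable P" "G y \<in> borel_measurable P"
      using gF_integrable[OF y] G_meas by auto
    show "integrable P (G y)"
      using gF_integrable[OF y] G_eq'[OF y]
      by (subst integrable_cong_AE[where g="gF y"]) auto
    show "(\<integral>s. G y s \<partial>P) = mean_grad P gF y"
      unfolding mean_grad_def using G_eq'[OF y] by (intro integral_cong_AE) auto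
    have *: "AE s in P. (norm (G y s - mean_grad P gF y))\<^sup>2 = (norm (gF y s - mean_grad P gF y))\<^sup>2"
      using G_eq'[OF y] by eventually_elim simp
    show "integrable P (\<lambda>s. (norm (G y s - mean_grad P gF y))\<^sup>2)"
      using var(1)[OF y] * by (subst integrable_cong_AE) auto
    have "(\<integral>s. (norm (G y s - mean_grad P gF y))\<^sup>2 \<partial>P) =
        (\<integral>s. (norm (gF y s - mean_grad P gF y))\<^sup>2 \<partial>P)"
      using * by (intro integral_cong_AE) auto
    then show "(\<integral>s. (norm (G y s - mean_grad P gF y))\<^sup>2 \<partial>P) \<le> a + b * (norm (y - xs))\<^sup>2"
      using var(2)[OF y] by simp
  qed (fact G)

  obtain p where p: "\<And>u. is_prox X \<phi> \<alpha> u (p u)"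
    using prox_exists[OF _ \<alpha>] xs by (metis empty_iff)
  have p_nonexp: "norm (p u - p w) \<le> norm (u - w)" for u w
    by (rule prox_nonexpansive[OF \<phi>_convex \<alpha> p p])
  have "continuous_on UNIV p"
    by (rule lipschitz_on_continuous_on[OF lipschitz_onI[where L=1]])
      (simp_all add: dist_norm p_nonexp)
  then have [measurable]: "p \<in> borel_measurable borel"
    by (rule borel_measurable_continuous_onI)
  have p_unique: "z = p u" if "is_prox X \<phi> \<alpha> u z" for z u
    using prox_nonexpansive[OF \<phi>_convex \<alpha> that p[of u]] by simp

  define y where "y n \<omega> = prox_iterates p \<alpha> G N (\<lambda>t j. \<xi> t j \<omega>) x1 n" for n \<omega>
  have y_0: "y 0 \<omega> = x1" and
    y_Suc: "y (Suc n) \<omega> = p (y n \<omega> - \<alpha> *\<^sub>R batch_grad G (N (Suc n)) (\<lambda>j. \<xi> (Suc n) j \<omega>) (y n \<omega>))"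
    for n \<omega>
    by (simp_all add: y_def)
  have yX: "y n \<omega> \<in> X" for n \<omega>
    by (cases n) (auto simp: y_0 y_Suc x1 is_prox_D(1)[OF p])

  \<comment> \<open>Almost surely none of the countably many samples falls into the null set on which
    the gradients \<open>G\<close> and \<open>gF\<close> differ, and proximal points are unique.\<close>
  have x_eq_y: "AE \<omega> in M. \<forall>n. x (Suc n) \<omega> = y n \<omega>"
  proof -
    have "AE \<omega> in M. \<forall>i\<in>I. \<forall>z\<in>X. G z (smp i \<omega>) = gF z (smp i \<omega>)"
    proof (subst AE_ball_countable; (intro ballI)?)
      fix i assume i: "i \<in> I"
      have "AE s in distr M P (smp i). \<forall>z\<in>X. G z s = gF z s"
        unfolding law[OF i] by (rule G_eq)
      then show "AE \<omega> in M. \<forall>z\<in>X. G z (smp i \<omega>) = gF z (smp i \<omega>)"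
        using sample_measurable[OF i] by (rule AE_distrD[rotated])
    qed auto
    with AE_space show ?thesis
    proof eventually_elim
      case (elim \<omega>)
      show ?case
      proof
        fix n show "x (Suc n) \<omega> = y n \<omega>"
        proof (induction n)
          case 0
          then show ?case
            using x_init elim by (simp add: y_0)
        next
          case (Suc n)
          have "batch_grad gF (N (Suc n)) (\<lambda>j. \<xi> (Suc n) j \<omega>) (y n \<omega>) =
              batch_grad G (N (Suc n)) (\<lambda>j. \<xi> (Suc n) j \<omega>) (y n \<omega>)"
            using elim(2) yX[of n \<omega>] unfolding batch_grad_def I_def smp_def
            by (auto intro!: sum.cong)
          then show ?case
            using p_unique[OF x_step[of "Suc n" \<omega>]] elim(1) by (simp add: Suc.IH y_Suc)
        qed
      qed
    qed
  qed

  define H where "H t = {(s, j) \<in> I. s < t}" for t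
  have HI: "H t \<subseteq> I" for t
    by (auto simp: H_def)
  have H_Suc: "H t \<union> Pair t ` {1..N t} = H (Suc t)" if "1 \<le> t" for t
    using that by (auto simp: H_def I_def less_Suc_eq)
  have y_past: "y n \<in> borel_measurable (past (H (Suc n)))" for n
  proof (induction n)
    case 0
    then show ?case
      by (simp add: y_0[abs_def])
  next
    case (Suc n)
    let ?F = "past (H (Suc (Suc n)))"
    have [measurable]: "y n \<in> borel_measurable ?F"
      by (rule past_mono[OF _ HI Suc.IH]) (auto simp: H_def)
    have "(\<lambda>\<omega>. G (y n \<omega>) (\<xi> (Suc n) j \<omega>)) \<in> borel_measurable ?F" if "j \<in> {1..N (Suc n)}" for j
    proof -
      have "smp (Suc n, j) \<in> measurable ?F P"
        using that by (intro past_sample_measurable HI) (auto simp: H_def I_def)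
      then have [measurable]: "\<xi> (Suc n) j \<in> measurable ?F P"
        by (simp add: smp_def)
      have "(\<lambda>\<omega>. (\<lambda>(y, s). G y s) (y n \<omega>, \<xi> (Suc n) j \<omega>)) \<in> borel_measurable ?F"
        by (rule measurable_compose[OF _ G]) measurable
      then show ?thesis
        by simp
    qed
    then have [measurable]:
      "(\<lambda>\<omega>. batch_grad G (N (Suc n)) (\<lambda>j. \<xi> (Suc n) j \<omega>) (y n \<omega>)) \<in> borel_measurable ?F"
      unfolding batch_grad_def by (intro borel_measurable_scaleR borel_measurable_sum) auto
    show ?case
      unfolding y_Suc[abs_def] by measurable
  qed
  have y_meas [measurable]: "y n \<in> borel_measurable M" for n
    by (rule past_measurable[OF HI y_past])

  define u where "u n = (\<integral>\<omega>. (norm (y n \<omega> - xs))\<^sup>2 \<partial>M)" for n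
  define e where
    "e n \<omega> = batch_grad G (N (Suc n)) (\<lambda>j. \<xi> (Suc n) j \<omega>) (y n \<omega>) - mean_grad P gF (y n \<omega>)" for n \<omega>
  define \<kappa> where "\<kappa> = \<alpha>\<^sup>2 / (1 - \<mu>)"
  have \<kappa>: "0 \<le> \<kappa>"
    using \<mu> by (simp add: \<kappa>_def)
  note step = prox_gradient_step[OF \<mu> opt yX p[unfolded \<alpha>_def], folded \<alpha>_def]
  have e_noise: "integrable M (\<lambda>\<omega>. (norm (e n \<omega>))\<^sup>2)"
      "(\<integral>\<omega>. (norm (e n \<omega>))\<^sup>2 \<partial>M) \<le> (a + b * u n) / real (N (Suc n))"
      "integrable M (\<lambda>\<omega>. e n \<omega> \<bullet> (y n \<omega> - xs))"
      "(\<integral>\<omega>. e n \<omega> \<bullet> (y n \<omega> - xs) \<partial>M) = 0"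
    if int: "integrable M (\<lambda>\<omega>. (norm (y n \<omega> - xs))\<^sup>2)" for n
  proof -
    define K where "K = N (Suc n)"
    have K: "1 \<le> K"
      using N by (simp add: K_def)
    define S where "S \<omega> = (\<Sum>j=1..K. noise (y n \<omega>) (smp (Suc n, j) \<omega>))" for \<omega>
    have past0: "y n \<in> borel_measurable (past (H (Suc n) \<union> Pair (Suc n) ` {1..0}))"
      using y_past by simp
    have sub: "H (Suc n) \<union> Pair (Suc n) ` {1..K} \<subseteq> I"
      unfolding K_def using H_Suc[of "Suc n"] HI by simp
    note bn = batch_noise[where J="\<lambda>j. H (Suc n) \<union> Pair (Suc n) ` {1..j}" and n=K and k="Pair (Suc n)",
        OF _ sub _ _ past0 yX int, folded u_def S_def]
    have pre: "\<And>j. H (Suc n) \<union> Pair (Suc n) ` {1..j} =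
        H (Suc n) \<union> Pair (Suc n) ` {1..0} \<union> Pair (Suc n) ` {1..j}"
      "Pair (Suc n) ` {1..K} \<inter> (H (Suc n) \<union> Pair (Suc n) ` {1..0}) = {}"
      "inj_on (Pair (Suc n)) {1..K}"
      by (auto simp: H_def inj_on_def)
    note bn = bn[OF pre]
    have e_S: "e n \<omega> = (1 / real K) *\<^sub>R S \<omega>" for \<omega>
      using K unfolding e_def S_def batch_grad_def K_def[symmetric]
      by (simp add: noise_eq[OF yX] smp_def sum_subtractf scaleR_diff_right sum_constant_scaleR)
    have sq: "(norm (e n \<omega>))\<^sup>2 = (norm (S \<omega>))\<^sup>2 / (real K)\<^sup>2" for \<omega>
      by (simp add: e_S power_divide)
    show "integrable M (\<lambda>\<omega>. (norm (e n \<omega>))\<^sup>2)"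
      unfolding sq using bn(2) by simp
    have "(\<integral>\<omega>. (norm (e n \<omega>))\<^sup>2 \<partial>M) \<le> (real K * (a + b * u n)) / (real K)\<^sup>2"
      unfolding sq using bn(3) by (simp add: divide_right_mono)
    also have "\<dots> = (a + b * u n) / real K"
      using K by (simp add: power2_eq_square)
    finally show "(\<integral>\<omega>. (norm (e n \<omega>))\<^sup>2 \<partial>M) \<le> (a + b * u n) / real (N (Suc n))"
      by (simp add: K_def)
    have ip: "e n \<omega> \<bullet> (y n \<omega> - xs) = S \<omega> \<bullet> (y n \<omega> - xs) / real K" for \<omega>
      by (simp add: e_S)
    show "integrable M (\<lambda>\<omega>. e n \<omega> \<bullet> (y n \<omega> - xs))" "(\<integral>\<omega>. e n \<omega> \<bullet> (y n \<omega> - xs) \<partial>M) = 0"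
      unfolding ip using bn(4,5) by simp_all
  qed
  have contraction: "(norm (y (Suc n) \<omega> - xs))\<^sup>2 \<le> (1 - \<mu> * c / L) * (norm (y n \<omega> - xs))\<^sup>2
      - 2 * \<alpha> * (e n \<omega> \<bullet> (y n \<omega> - xs)) + \<kappa> * (norm (e n \<omega>))\<^sup>2" for n \<omega>
    unfolding y_Suc e_def \<kappa>_def by (rule step(1))
  have rhs_integrable: "integrable M (\<lambda>\<omega>. (1 - \<mu> * c / L) * (norm (y n \<omega> - xs))\<^sup>2
      - 2 * \<alpha> * (e n \<omega> \<bullet> (y n \<omega> - xs)) + \<kappa> * (norm (e n \<omega>))\<^sup>2)"
    if int: "integrable M (\<lambda>\<omega>. (norm (y n \<omega> - xs))\<^sup>2)" for n
    using int e_noise(1,3)[OF int]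
    by (intro Bochner_Integration.integrable_add Bochner_Integration.integrable_diff
        integrable_mult_right) auto
  have int: "integrable M (\<lambda>\<omega>. (norm (y n \<omega> - xs))\<^sup>2)" for n
  proof (induction n)
    case 0
    then show ?case
      by (simp add: y_0)
  next
    case (Suc n)
    show ?case
      by (rule Bochner_Integration.integrable_bound[OF rhs_integrable[OF Suc.IH]])
        (auto intro!: AE_I2 order_trans[OF contraction abs_ge_self])
  qed
  have rec: "u (Suc n) \<le> (1 - \<mu> * c / L) * u n + \<kappa> * ((a + b * u n) / real (N (Suc n)))" for n
  proof -
    have "u (Suc n) \<le> (\<integral>\<omega>. (1 - \<mu> * c / L) * (norm (y n \<omega> - xs))\<^sup>2
      - 2 * \<alpha> * (e n \<omega> \<bullet> (y n \<omega> - xs)) + \<kappa> * (norm (e n \<omega>))\<^sup>2 \<partial>M)"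
      unfolding u_def by (intro integral_mono int rhs_integrable contraction)
    also have "\<dots> = (1 - \<mu> * c / L) * u n + \<kappa> * (\<integral>\<omega>. (norm (e n \<omega>))\<^sup>2 \<partial>M)"
      using e_noise[OF int[of n]] int[of n] unfolding u_def
      by (subst Bochner_Integration.integral_add Bochner_Integration.integral_diff; simp)+
    also have "\<dots> \<le> (1 - \<mu> * c / L) * u n + \<kappa> * ((a + b * u n) / real (N (Suc n)))"
      by (intro add_left_mono mult_left_mono e_noise(2) int \<kappa>)
    finally show ?thesis .
  qed
  have x_sq_eq: "AE \<omega> in M. (norm (x (Suc n) \<omega> - xs))\<^sup>2 = (norm (y n \<omega> - xs))\<^sup>2" for n
    using x_eq_y by eventually_elim auto
  have x_int: "integrable M (\<lambda>\<omega>. (norm (x (Suc n) \<omega> - xs))\<^sup>2)" for n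
    using int[of n] x_sq_eq[of n] x_meas[of "Suc n"] by (subst integrable_cong_AE) auto
  have x_u: "(\<integral>\<omega>. (norm (x (Suc n) \<omega> - xs))\<^sup>2 \<partial>M) = u n" for n
    unfolding u_def using x_sq_eq[of n] x_meas[of "Suc n"] by (intro integral_cong_AE) auto
  have gap_bound: "expectation_le M
      (\<lambda>\<omega>. composite_obj P F \<phi> (x (Suc (Suc n)) \<omega>) - composite_obj P F \<phi> xs)
      ((a + b * u n) / real (N (Suc n)) / 2 + u (Suc n) / 2 + L / (2 * \<mu>) * u n)" (is "expectation_le M ?gap _")
    for n
  proof -
    let ?B = "\<lambda>\<omega>. (norm (e n \<omega>))\<^sup>2 / 2 + (norm (y (Suc n) \<omega> - xs))\<^sup>2 / 2
      + L / (2 * \<mu>) * (norm (y n \<omega> - xs))\<^sup>2"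
    have B_int: "integrable M ?B"
      using int[of n] int[of "Suc n"] e_noise(1)[OF int[of n]]
      by (intro Bochner_Integration.integrable_add integrable_divide integrable_mult_right) auto
    have x2: "x (Suc (Suc n)) \<in> measurable M (restrict_space borel X)"
      using x_meas[of "Suc (Suc n)"] x_in[of "Suc (Suc n)"]
      by (intro measurable_restrict_space2) auto
    have "mean_obj P F \<in> borel_measurable (restrict_space borel X)"
      by (rule borel_measurable_continuous_on_restrict[OF mean_obj_continuous])
    from measurable_compose[OF x2 this]
    have [measurable]: "(\<lambda>\<omega>. mean_obj P F (x (Suc (Suc n)) \<omega>)) \<in> borel_measurable M" .
    \<comment> \<open>This concerns \<open>x\<close> itself, not the almost surely equal \<open>y\<close>: without completeness of the
        measure, measurability does not pass from one to the other.\<close>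
    have [measurable]: "(\<lambda>\<omega>. \<phi> (x (Suc (Suc n)) \<omega>)) \<in> borel_measurable M"
    proof (rule prox_value_measurable[OF \<alpha> x_meas])
      show "\<exists>u. is_prox X \<phi> \<alpha> u (x (Suc (Suc n)) \<omega>)" if "\<omega> \<in> space M" for \<omega>
        by (rule exI, rule x_step[OF _ that]) simp
    qed simp
    have gap_meas: "?gap \<in> borel_measurable M"
      unfolding composite_obj_def by measurable
    have gap0: "0 \<le> ?gap \<omega>" if "\<omega> \<in> space M" for \<omega>
      using opt x_in[OF _ that, of "Suc (Suc n)"] by (auto simp: is_arg_min_def not_less)
    have gapB: "AE \<omega> in M. ?gap \<omega> \<le> ?B \<omega>"
      using x_eq_y
    proof eventually_elim
      case (elim \<omega>)
      then show ?case
        unfolding y_Suc e_def elim[rule_format] by (intro step(2)) 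
    qed
    have gap_int: "integrable M ?gap"
      using gapB gap0 by (intro Bochner_Integration.integrable_bound[OF B_int gap_meas]) auto
    have "(\<integral>\<omega>. ?gap \<omega> \<partial>M) \<le> (\<integral>\<omega>. ?B \<omega> \<partial>M)"
      by (intro integral_mono_AE gap_int B_int gapB)
    also have "\<dots> = (\<integral>\<omega>. (norm (e n \<omega>))\<^sup>2 \<partial>M) / 2 + u (Suc n) / 2 + L / (2 * \<mu>) * u n"
      using int[of n] int[of "Suc n"] e_noise(1)[OF int[of n]] unfolding u_def by simp
    also have "\<dots> \<le> (a + b * u n) / real (N (Suc n)) / 2 + u (Suc n) / 2 + L / (2 * \<mu>) * u n"
      by (intro add_right_mono divide_right_mono e_noise(2) int) simp
    finally show ?thesis
      using gap_int unfolding expectation_le_def by simp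
  qed
  show ?thesis
  proof (rule that[OF ab])
    fix t :: nat assume "1 \<le> t"
    then obtain n where t: "t = Suc n"
      by (cases t) auto
    show "integrable M (\<lambda>\<omega>. (norm (x t \<omega> - xs))\<^sup>2)"
      using x_int by (simp add: t)
    show "(\<integral>\<omega>. (norm (x (Suc t) \<omega> - xs))\<^sup>2 \<partial>M) \<le>
      (1 - \<mu> * c / L) * (\<integral>\<omega>. (norm (x t \<omega> - xs))\<^sup>2 \<partial>M)
      + (\<mu> / L)\<^sup>2 / (1 - \<mu>) * ((a + b * (\<integral>\<omega>. (norm (x t \<omega> - xs))\<^sup>2 \<partial>M)) / real (N t))"
      using rec[of n] unfolding t x_u \<kappa>_def \<alpha>_def .
    show "expectation_le M (\<lambda>\<omega>. composite_obj P F \<phi> (x (Suc t) \<omega>) - composite_obj P F \<phi> xs)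
        ((a + b * (\<integral>\<omega>. (norm (x t \<omega> - xs))\<^sup>2 \<partial>M)) / real (N t) / 2
          + (\<integral>\<omega>. (norm (x (Suc t) \<omega> - xs))\<^sup>2 \<partial>M) / 2
          + L / (2 * \<mu>) * (\<integral>\<omega>. (norm (x t \<omega> - xs))\<^sup>2 \<partial>M))"
      using gap_bound[of n] unfolding t x_u .
  qed
qed

section \<open>The rate of a perturbed contraction\<close>

text \<open>
  Once \<open>b * \<zeta> ^ t\<close> has become smaller than half the distance from \<open>q\<close> to \<open>r\<close>, the recursion contracts
  with a factor \<open>s < r\<close>, and the remaining forcing term decays at least as fast as \<open>r ^ t\<close>. Hence any rate
  \<open>r > q\<close> with \<open>r \<ge> \<zeta>\<close> is attained, including \<open>r = \<zeta>\<close>, without a polynomial factor.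
\<close>

lemma perturbed_contraction_rate:
  fixes u :: "nat \<Rightarrow> real"
  assumes u: "\<And>t. 1 \<le> t \<Longrightarrow> 0 \<le> u t"
    and q: "0 \<le> q" "q < r" and \<zeta>: "0 < \<zeta>" "\<zeta> \<le> r" "\<zeta> < 1" and ab: "0 \<le> a" "0 \<le> b"
    and rec: "\<And>t. 1 \<le> t \<Longrightarrow> u (Suc t) \<le> q * u t + (a + b * u t) * \<zeta> ^ t"
  obtains C where "C > 0" "\<And>t. 1 \<le> t \<Longrightarrow> u t \<le> C * r ^ t"
proof -
  define s where "s = (q + r) / 2"
  have r: "0 < r" and s: "0 < r - s" "0 \<le> s"
    using q \<zeta> by (auto simp: s_def)
  have "(\<lambda>t. b * \<zeta> ^ t) \<longlonglongrightarrow> b * 0"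
    using \<zeta> by (intro tendsto_mult tendsto_const LIMSEQ_realpow_zero) auto
  then have "\<forall>\<^sub>F t in sequentially. b * \<zeta> ^ t < s - q"
    using q by (intro order_tendstoD(2)) (auto simp: s_def)
  then obtain t0 where t0: "\<And>t. t0 \<le> t \<Longrightarrow> b * \<zeta> ^ t < s - q"
    unfolding eventually_sequentially by blast
  \<comment> \<open>The sum covers the finitely many early steps; the second term is the fixed point of the
    contracting recursion for \<open>u t / r ^ t\<close>.\<close>
  define C where "C = (\<Sum>t=1..max 1 t0. u t / r ^ t) + a / (r - s) + 1"
  have sum0: "0 \<le> (\<Sum>t=1..max 1 t0. u t / r ^ t)"
    using u r by (intro sum_nonneg) auto
  have C: "0 < C" "a \<le> (r - s) * C"
  proof -
    show "0 < C"
      using sum0 ab s by (simp add: C_def add_nonneg_pos)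
    have "(r - s) * (a / (r - s)) \<le> (r - s) * C"
      using sum0 s by (intro mult_left_mono) (auto simp: C_def)
    then show "a \<le> (r - s) * C"
      using s by simp
  qed
  have early: "u t \<le> C * r ^ t" if "1 \<le> t" "t \<le> max 1 t0" for t
  proof -
    have "u t / r ^ t \<le> (\<Sum>t=1..max 1 t0. u t / r ^ t)"
      using that u r by (intro member_le_sum) auto
    also have "\<dots> \<le> C"
      using ab s by (simp add: C_def)
    finally show ?thesis
      using r by (simp add: divide_le_eq)
  qed
  have "u t \<le> C * r ^ t" if "max 1 t0 \<le> t" for t
    using that
  proof (induction t rule: dec_induct)
    case base
    then show ?case
      by (intro early) auto
  next
    case (step t)
    have t: "1 \<le> t" "t0 \<le> t"
      using step.hyps by auto
    have "u (Suc t) \<le> (q + b * \<zeta> ^ t) * u t + a * \<zeta> ^ t"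
      using rec[OF t(1)] by (simp add: algebra_simps)
    also have "\<dots> \<le> s * (C * r ^ t) + a * r ^ t"
    proof (intro add_mono mult_mono)
      show "q + b * \<zeta> ^ t \<le> s"
        using t0[OF t(2)] by simp
      show "\<zeta> ^ t \<le> r ^ t"
        using \<zeta> by (intro power_mono) auto
    qed (use step.IH s u t ab \<zeta> in auto)
    also have "\<dots> \<le> s * (C * r ^ t) + (r - s) * C * r ^ t"
      using C r by (intro add_left_mono mult_right_mono) auto
    also have "\<dots> = C * r ^ Suc t"
      by (simp add: algebra_simps)
    finally show ?case .
  qed
  with early have "u t \<le> C * r ^ t" if "1 \<le> t" for t
    using that by (cases "t \<le> max 1 t0") auto
  with C(1) show ?thesis
    by (rule that)
qed

section \<open>Number of samples\<close>

lemma batch_size_lower: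
  assumes "1 \<le> N0" "0 < \<zeta>" "\<zeta> < 1"
  shows "(1 / \<zeta>) ^ t \<le> real (batch_size N0 \<zeta> t)"
proof -
  have "(1 / \<zeta>) ^ t = \<zeta> powr (- real t)"
    using assms by (simp add: powr_minus powr_realpow power_one_over inverse_eq_divide)
  also have "\<dots> \<le> real (nat \<lceil>\<zeta> powr (- real t)\<rceil>)"
    by (rule real_nat_ceiling_ge)
  also have "\<dots> \<le> real (batch_size N0 \<zeta> t)"
    unfolding batch_size_def of_nat_le_iff
    using mult_le_mono1[OF assms(1), of "nat \<lceil>\<zeta> powr (- real t)\<rceil>"] by (simp only: mult_1)
  finally show ?thesis .
qed

lemma batch_size_upper:
  assumes "0 < \<zeta>" "\<zeta> < 1"
  shows "real (batch_size N0 \<zeta> t) \<le> 2 * real N0 * (1 / \<zeta>) ^ t"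
proof -
  have eq: "\<zeta> powr (- real t) = (1 / \<zeta>) ^ t"
    using assms by (simp add: powr_minus powr_realpow power_one_over inverse_eq_divide)
  have "1 \<le> (1 / \<zeta>) ^ t"
    using assms by (intro one_le_power) simp
  then have "real (nat \<lceil>\<zeta> powr (- real t)\<rceil>) \<le> 2 * (1 / \<zeta>) ^ t"
    unfolding eq by linarith
  then have "real N0 * real (nat \<lceil>\<zeta> powr (- real t)\<rceil>) \<le> real N0 * (2 * (1 / \<zeta>) ^ t)"
    by (intro mult_left_mono) auto
  then show ?thesis
    by (simp add: batch_size_def)
qed

lemma total_batch_size_upper:
  assumes "0 < \<zeta>" "\<zeta> < 1"
  shows "(\<Sum>\<tau>=1..T. real (batch_size N0 \<zeta> \<tau>)) \<le> 2 * real N0 / (1 - \<zeta>) * (1 / \<zeta>) ^ T"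
proof (induction T)
  case 0
  then show ?case
    using assms by simp
next
  case (Suc T)
  have "(\<Sum>\<tau>=1..Suc T. real (batch_size N0 \<zeta> \<tau>)) \<le>
      2 * real N0 / (1 - \<zeta>) * (1 / \<zeta>) ^ T + 2 * real N0 * (1 / \<zeta>) ^ Suc T"
    using Suc.IH batch_size_upper[OF assms, of N0 "Suc T"] by simp
  also have "\<dots> = 2 * real N0 / (1 - \<zeta>) * (1 / \<zeta>) ^ Suc T"
    using assms by (simp add: field_simps)
  finally show ?case .
qed

text \<open>
  Turns an error of order \<open>r ^ t\<close> into the number of iterations and of samples. For small \<open>\<epsilon>\<close>, with
  \<open>T = \<lceil>log\<^bsub>1/r\<^esub> (A / \<epsilon>)\<rceil>\<close> the samples number at most a constant times
  \<open>(1 / \<zeta>) ^ T = (1 / r) ^ T * (r / \<zeta>) ^ T\<close>, where the first factor is \<open>O(1 / \<epsilon>)\<close> and the second is bounded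
  by the excess factor for \<open>\<rho>\<close>, because replacing \<open>\<rho>\<close> by \<open>r \<le> \<rho>\<close> increases neither its base
  nor its exponent. If \<open>r = \<zeta>\<close>, the second factor is 1 and only \<open>O(1 / \<epsilon>)\<close> is left.
  
  The rate is required from \<open>t = 2\<close> on, since an objective bound is available only for points that a
  proximal step has produced. The predicate \<open>achieves t \<delta>\<close> abstracts from the error measure.
\<close>

lemma geometric_rate_complexity:
  fixes achieves :: "nat \<Rightarrow> real \<Rightarrow> bool" and w :: real
  assumes rate: "\<And>t. 2 \<le> t \<Longrightarrow> achieves t (A * r ^ t)"
    and mono: "\<And>t \<delta> \<delta>'. achieves t \<delta> \<Longrightarrow> \<delta> \<le> \<delta>' \<Longrightarrow> achieves t \<delta>'"
    and A: "0 < A" and \<zeta>: "0 < \<zeta>" and r: "\<zeta> \<le> r" "r \<le> \<rho>" "\<rho> < 1" and N0: "1 \<le> N0" and w: "0 < w"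
    and sharp: "\<And>a. 0 < a \<Longrightarrow> a \<le> 1 \<Longrightarrow> \<zeta> = 1 - a * w \<Longrightarrow> r = \<zeta>"
  shows "\<exists>A>0. \<exists>(T :: real \<Rightarrow> nat) (h :: real \<Rightarrow> real).
        (\<lambda>\<epsilon>. real (T \<epsilon>)) \<in> O[at_right 0](\<lambda>\<epsilon>. log (1 / \<rho>) (A / \<epsilon>)) \<and>
        h \<in> O[at_right 0](\<lambda>\<epsilon>. 1 / \<epsilon>) \<and>
        (\<forall>\<epsilon>>0. 1 \<le> T \<epsilon> \<and> achieves (T \<epsilon>) \<epsilon> \<and>
           (\<Sum>\<tau>=1..T \<epsilon>. real (batch_size N0 \<zeta> \<tau>))
             \<le> real N0 * \<rho> * h \<epsilon> / (1 - \<zeta>) * (\<rho> / \<zeta>) powr (log (1 / \<rho>) (A / \<epsilon>) + 1)) \<and>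
        (\<forall>a. 0 < a \<and> a \<le> 1 \<and> \<zeta> = 1 - a * w \<longrightarrow>
           (\<exists>h' :: real \<Rightarrow> real. h' \<in> O[at_right 0](\<lambda>\<epsilon>. 1 / \<epsilon>) \<and>
             (\<forall>\<epsilon>>0. (\<Sum>\<tau>=1..T \<epsilon>. real (batch_size N0 \<zeta> \<tau>)) \<le> real N0 * \<rho> * h' \<epsilon> / (a * w))))"
proof -
  have pos: "0 < r" "r < 1" "0 < \<rho>" "\<zeta> < 1" "0 < real N0"
    using \<zeta> r N0 by auto
  define l where "l b \<epsilon> = log (1 / b) (A / \<epsilon>)" for b \<epsilon> :: real
  define T where "T \<epsilon> = max 2 (nat \<lceil>l r \<epsilon>\<rceil>)" for \<epsilon>
  define S where "S \<epsilon> = (\<Sum>\<tau>=1..T \<epsilon>. real (batch_size N0 \<zeta> \<tau>))" for \<epsilon>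
  have S0: "0 \<le> S \<epsilon>" for \<epsilon>
    unfolding S_def by (intro sum_nonneg) auto
  have powr_l: "(1 / r) powr l r \<epsilon> = A / \<epsilon>" if "0 < \<epsilon>" for \<epsilon>
    using that pos A unfolding l_def by (intro powr_log_cancel) auto
  have small: "\<forall>\<^sub>F \<epsilon> in at_right 0. 0 < \<epsilon> \<and> \<epsilon> < A * r"
    using pos A by (auto simp: eventually_at_right_field intro!: exI[of _ "A * r"])

  have l_small: "1 < l r \<epsilon>" "l r \<epsilon> \<le> l \<rho> \<epsilon>" "real (T \<epsilon>) \<le> l r \<epsilon> + 1"
    if "0 < \<epsilon>" "\<epsilon> < A * r" for \<epsilon>
  proof -
    have "1 / r < A / \<epsilon>"
      using that pos by (simp add: field_simps)
    then show l1: "1 < l r \<epsilon>"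
      unfolding l_def using pos by (subst less_log_iff) (auto simp: that A)
    have "0 < ln (A / \<epsilon>)"
      using \<open>1 / r < A / \<epsilon>\<close> pos by (intro ln_gt_zero) (auto elim!: order.strict_trans[rotated])
    moreover have "0 < ln (1 / \<rho>)" "ln (1 / \<rho>) \<le> ln (1 / r)"
      using pos r by (auto simp: field_simps)
    ultimately show "l r \<epsilon> \<le> l \<rho> \<epsilon>"
      unfolding l_def log_def by (intro divide_left_mono mult_pos_pos) auto
    show "real (T \<epsilon>) \<le> l r \<epsilon> + 1"
      unfolding T_def using l1 by linarith
  qed
  have pow_small: "(1 / r) ^ T \<epsilon> \<le> A / \<epsilon> / r"
    if "0 < \<epsilon>" "\<epsilon> < A * r" for \<epsilon>
  proof -
    have "(1 / r) ^ T \<epsilon> = (1 / r) powr real (T \<epsilon>)"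
      using pos by (simp add: powr_realpow)
    also have "\<dots> \<le> (1 / r) powr (l r \<epsilon> + 1)"
      using pos l_small(3)[OF that] by (intro powr_mono) auto
    also have "\<dots> = A / \<epsilon> / r"
      using powr_l[OF that(1)] pos by (simp add: powr_add)
    finally show ?thesis .
  qed
  have S_small: "S \<epsilon> \<le> 2 * real N0 / (1 - \<zeta>) * (A / \<epsilon> / r * (r / \<zeta>) ^ T \<epsilon>)"
    if "0 < \<epsilon>" "\<epsilon> < A * r" for \<epsilon>
  proof -
    have "S \<epsilon> \<le> 2 * real N0 / (1 - \<zeta>) * (1 / \<zeta>) ^ T \<epsilon>"
      unfolding S_def using \<zeta> pos by (intro total_batch_size_upper) auto
    also have "(1 / \<zeta>) ^ T \<epsilon> = (1 / r) ^ T \<epsilon> * (r / \<zeta>) ^ T \<epsilon>"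
      using pos by (simp add: power_mult_distrib[symmetric])
    also have "2 * real N0 / (1 - \<zeta>) * \<dots> \<le> 2 * real N0 / (1 - \<zeta>) * (A / \<epsilon> / r * (r / \<zeta>) ^ T \<epsilon>)"
      using pos \<zeta> pow_small[OF that] by (intro mult_left_mono mult_right_mono) auto
    finally show ?thesis .
  qed

  \<comment> \<open>This choice makes the sample bound an equality for every \<open>\<epsilon>\<close>; its content is then the
    order of \<open>h\<close>, which concerns small \<open>\<epsilon>\<close> only.\<close>
  define h where "h \<epsilon> = S \<epsilon> * (1 - \<zeta>) / (real N0 * \<rho> * (\<rho> / \<zeta>) powr (l \<rho> \<epsilon> + 1))" for \<epsilon>
  have powr_pos: "0 < (\<rho> / \<zeta>) powr (l \<rho> \<epsilon> + 1)" for \<epsilon>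
    using pos \<zeta> by simp
  have T_bigo: "(\<lambda>\<epsilon>. real (T \<epsilon>)) \<in> O[at_right 0](\<lambda>\<epsilon>. log (1 / \<rho>) (A / \<epsilon>))"
    unfolding l_def[symmetric]
  proof (rule bigoI[of _ 2])
    show "\<forall>\<^sub>F \<epsilon> in at_right 0. norm (real (T \<epsilon>)) \<le> 2 * norm (l \<rho> \<epsilon>)"
      using small
    proof eventually_elim
      case (elim \<epsilon>)
      then show ?case
        using l_small[of \<epsilon>] by simp
    qed
  qed
  have h_bigo: "h \<in> O[at_right 0](\<lambda>\<epsilon>. 1 / \<epsilon>)"
  proof (rule bigoI[of _ "2 * A / (r * \<rho>)"])
    show "\<forall>\<^sub>F \<epsilon> in at_right 0. norm (h \<epsilon>) \<le> 2 * A / (r * \<rho>) * norm (1 / \<epsilon>)"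
      using small
    proof eventually_elim
      case (elim \<epsilon>)
      then have \<epsilon>: "0 < \<epsilon>" "\<epsilon> < A * r"
        by auto
      let ?p = "(\<rho> / \<zeta>) powr (l \<rho> \<epsilon> + 1)"
      have "(r / \<zeta>) ^ T \<epsilon> \<le> (\<rho> / \<zeta>) ^ T \<epsilon>"
        using r \<zeta> pos by (intro power_mono divide_right_mono) auto
      also have "\<dots> = (\<rho> / \<zeta>) powr real (T \<epsilon>)"
        using pos \<zeta> by (simp add: powr_realpow)
      also have "\<dots> \<le> ?p"
        using r \<zeta> l_small[OF \<epsilon>] by (intro powr_mono) auto
      finally have "2 * real N0 / (1 - \<zeta>) * (A / \<epsilon> / r * (r / \<zeta>) ^ T \<epsilon>)
          \<le> 2 * real N0 / (1 - \<zeta>) * (A / \<epsilon> / r * ?p)"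
        using pos A \<epsilon> by (intro mult_left_mono) auto
      then have S: "S \<epsilon> \<le> 2 * real N0 / (1 - \<zeta>) * (A / \<epsilon> / r * ?p)"
        using S_small[OF \<epsilon>] by linarith
      have "h \<epsilon> \<le> 2 * real N0 / (1 - \<zeta>) * (A / \<epsilon> / r * ?p) * (1 - \<zeta>) / (real N0 * \<rho> * ?p)"
        unfolding h_def using S pos powr_pos[of \<epsilon>]
        by (intro divide_right_mono mult_right_mono) auto
      also have "\<dots> = 2 * A / (r * \<rho>) * (1 / \<epsilon>)"
        using pos powr_pos[of \<epsilon>] \<epsilon> by (simp add: divide_simps)
      finally have "h \<epsilon> \<le> 2 * A / (r * \<rho>) * (1 / \<epsilon>)" .
      moreover have "0 \<le> h \<epsilon>"
        unfolding h_def using S0 pos by (intro divide_nonneg_nonneg mult_nonneg_nonneg) auto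
      ultimately show ?case
        using \<epsilon> by simp
    qed
  qed
  have T_achieves: "achieves (T \<epsilon>) \<epsilon>" if \<epsilon>: "0 < \<epsilon>" for \<epsilon>
  proof (rule mono[OF rate])
    show "2 \<le> T \<epsilon>"
      by (simp add: T_def)
    have "l r \<epsilon> \<le> real (T \<epsilon>)"
      unfolding T_def by linarith
    then have "A / \<epsilon> \<le> (1 / r) powr real (T \<epsilon>)"
      unfolding powr_l[OF \<epsilon>, symmetric] using pos by (intro powr_mono) auto
    also have "\<dots> = 1 / r ^ T \<epsilon>"
      using pos by (simp add: powr_realpow power_one_over)
    finally show "A * r ^ T \<epsilon> \<le> \<epsilon>"
      using \<epsilon> pos by (simp add: field_simps)
  qed
  have S_h: "S \<epsilon> \<le> real N0 * \<rho> * h \<epsilon> / (1 - \<zeta>) * (\<rho> / \<zeta>) powr (l \<rho> \<epsilon> + 1)" for \<epsilon>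
    unfolding h_def using pos powr_pos[of \<epsilon>] by simp
  have sharp_bound: "\<exists>h' :: real \<Rightarrow> real. h' \<in> O[at_right 0](\<lambda>\<epsilon>. 1 / \<epsilon>) \<and>
      (\<forall>\<epsilon>>0. S \<epsilon> \<le> real N0 * \<rho> * h' \<epsilon> / (a * w))"
    if a: "0 < a" "a \<le> 1" "\<zeta> = 1 - a * w" for a
  proof (intro exI conjI allI impI)
    let ?h = "\<lambda>\<epsilon>. S \<epsilon> * (a * w / (real N0 * \<rho>))"
    have rz: "r = \<zeta>"
      using a by (rule sharp)
    show "S \<epsilon> \<le> real N0 * \<rho> * ?h \<epsilon> / (a * w)" for \<epsilon>
      using pos a(1) w by simp
    have S_bigo: "S \<in> O[at_right 0](\<lambda>\<epsilon>. 1 / \<epsilon>)"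
    proof (rule bigoI[of _ "2 * real N0 / (1 - \<zeta>) * (A / r)"])
      show "\<forall>\<^sub>F \<epsilon> in at_right 0. norm (S \<epsilon>) \<le> 2 * real N0 / (1 - \<zeta>) * (A / r) * norm (1 / \<epsilon>)"
        using small
      proof eventually_elim
        case (elim \<epsilon>)
        then show ?case
          using S_small[of \<epsilon>] S0[of \<epsilon>] \<zeta> by (simp add: rz field_simps)
      qed
    qed
    show "?h \<in> O[at_right 0](\<lambda>\<epsilon>. 1 / \<epsilon>)"
      using S_bigo pos a(1) w by (subst landau_o.big.cmult_in_iff') auto
  qed
  show ?thesis
    using A T_bigo h_bigo T_achieves S_h sharp_bound
    by (intro exI[of _ A] conjI exI[of _ T] exI[of _ h])
      (auto simp: S_def l_def T_def)
qed

section \<open>The oracle complexity\<close>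

theorem corollary3:
  fixes X :: "'a::euclidean_space set"
    and P :: "'b measure"
    and M :: "'w measure"
    and F :: "'a \<Rightarrow> 'b \<Rightarrow> real"
    and gF :: "'a \<Rightarrow> 'b \<Rightarrow> 'a"
    and \<phi> :: "'a \<Rightarrow> real"
    and L c \<sigma>L \<mu> \<theta> \<zeta> \<rho> :: real
    and N0 :: nat
    and \<xi> :: "nat \<Rightarrow> nat \<Rightarrow> 'w \<Rightarrow> 'b"
    and x1 xstar :: 'a
    and x :: "nat \<Rightarrow> 'w \<Rightarrow> 'a"
  assumes problem: "composite_problem X P F gF \<phi> L c"
    and solution: "is_arg_min (composite_obj P F \<phi>) (\<lambda>z. z \<in> X) xstar"
    and noise: "multiplicative_noise X P gF \<sigma>L"
    and \<mu>: "0 < \<mu>" "\<mu> < 1"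
    and \<theta>: "0 < \<theta>" "\<theta> < 1" "\<theta> < 1 - \<mu> * c / L"
    and \<zeta>: "0 < \<zeta>" "\<zeta> < 1"
    and N0: "1 \<le> N0"
    and \<rho>: "\<rho> = max (1 - \<mu> * (c / (2 * L)) + \<theta>) \<zeta>" "\<rho> < 1"
    and probability: "prob_space M"
    and algorithm:
      "stochastic_prox_gradient M X P F gF \<phi> (\<lambda>_. \<mu> / L) (batch_size N0 \<zeta>) \<xi> x1 x"
  shows
    "(\<exists>A>0. \<exists>(T :: real \<Rightarrow> nat) (h :: real \<Rightarrow> real).
        (\<lambda>\<epsilon>. real (T \<epsilon>)) \<in> O[at_right 0](\<lambda>\<epsilon>. log (1 / \<rho>) (A / \<epsilon>)) \<and>
        h \<in> O[at_right 0](\<lambda>\<epsilon>. 1 / \<epsilon>) \<and>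
        (\<forall>\<epsilon>>0. 1 \<le> T \<epsilon> \<and>
           expectation_le M
             (\<lambda>\<omega>. composite_obj P F \<phi> (x (T \<epsilon>) \<omega>) - optimal_value X P F \<phi>) \<epsilon> \<and>
           (\<Sum>\<tau>=1..T \<epsilon>. real (batch_size N0 \<zeta> \<tau>))
             \<le> real N0 * \<rho> * h \<epsilon> / (1 - \<zeta>) * (\<rho> / \<zeta>) powr (log (1 / \<rho>) (A / \<epsilon>) + 1)) \<and>
        (\<forall>a. 0 < a \<and> a \<le> 1 \<and> \<zeta> = 1 - a * (\<mu> * (c / (2 * L)) + \<theta>) \<longrightarrow>
           (\<exists>h' :: real \<Rightarrow> real. h' \<in> O[at_right 0](\<lambda>\<epsilon>. 1 / \<epsilon>) \<and>
             (\<forall>\<epsilon>>0. (\<Sum>\<tau>=1..T \<epsilon>. real (batch_size N0 \<zeta> \<tau>))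
                \<le> real N0 * \<rho> * h' \<epsilon> / (a * (\<mu> * (c / (2 * L)) + \<theta>))))))
     \<and>
     (\<exists>A>0. \<exists>(T :: real \<Rightarrow> nat) (h :: real \<Rightarrow> real).
        (\<lambda>\<epsilon>. real (T \<epsilon>)) \<in> O[at_right 0](\<lambda>\<epsilon>. log (1 / \<rho>) (A / \<epsilon>)) \<and>
        h \<in> O[at_right 0](\<lambda>\<epsilon>. 1 / \<epsilon>) \<and>
        (\<forall>\<epsilon>>0. 1 \<le> T \<epsilon> \<and>
           expectation_le M (\<lambda>\<omega>. (norm (x (T \<epsilon>) \<omega> - xstar))\<^sup>2) \<epsilon> \<and>
           (\<Sum>\<tau>=1..T \<epsilon>. real (batch_size N0 \<zeta> \<tau>))
             \<le> real N0 * \<rho> * h \<epsilon> / (1 - \<zeta>) * (\<rho> / \<zeta>) powr (log (1 / \<rho>) (A / \<epsilon>) + 1)) \<and>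
        (\<forall>a. 0 < a \<and> a \<le> 1 \<and> \<zeta> = 1 - a * (\<mu> * (c / (2 * L)) + \<theta>) \<longrightarrow>
           (\<exists>h' :: real \<Rightarrow> real. h' \<in> O[at_right 0](\<lambda>\<epsilon>. 1 / \<epsilon>) \<and>
             (\<forall>\<epsilon>>0. (\<Sum>\<tau>=1..T \<epsilon>. real (batch_size N0 \<zeta> \<tau>))
                \<le> real N0 * \<rho> * h' \<epsilon> / (a * (\<mu> * (c / (2 * L)) + \<theta>))))))"
proof -
  interpret composite_problem X P F gF \<phi> L c
    by (rule problem)
  let ?g = "composite_obj P F \<phi>"
  define q where "q = 1 - \<mu> * c / L"
  define w where "w = \<mu> * (c / (2 * L)) + \<theta>"
  define u where "u t = (\<integral>\<omega>. (norm (x t \<omega> - xstar))\<^sup>2 \<partial>M)" for t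
  have half: "\<mu> * (c / (2 * L)) = (1 - q) / 2"
    using L_pos by (simp add: q_def field_simps)
  have q: "0 < q"
    using \<theta> by (simp add: q_def)
  have \<theta>_half: "\<theta> < (1 - q) / 2"
    using \<rho> unfolding half by linarith
  have w: "0 < w" "1 - w > q"
    using \<theta> \<theta>_half q unfolding w_def half by (auto simp: field_simps)
  \<comment> \<open>The rate \<open>\<zeta>\<close> at which the sampling error decays is attained as soon as it is slower than
    the contraction; otherwise \<open>\<rho>\<close> serves.\<close>
  define r where "r = (if q < \<zeta> then \<zeta> else \<rho>)"
  have r: "q < r" "\<zeta> \<le> r" "r \<le> \<rho>"
  proof -
    have "1 - (1 - q) / 2 + \<theta> \<le> \<rho>" "\<zeta> \<le> \<rho>"
      using \<rho>(1) unfolding half by auto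
    moreover have "q < 1"
      using \<theta>(1) \<theta>_half by simp
    ultimately have "q < \<rho>" "\<zeta> \<le> \<rho>"
      using \<theta>(1) by argo+
    then show "q < r" "\<zeta> \<le> r" "r \<le> \<rho>"
      by (auto simp: r_def)
  qed
  \<comment> \<open>Here \<open>\<zeta> \<ge> 1 - w > q\<close>, although \<open>\<zeta>\<close> may be smaller than \<open>\<rho>\<close>.\<close>
  have sharp: "r = \<zeta>" if "0 < a" "a \<le> 1" "\<zeta> = 1 - a * w" for a
  proof -
    have "a * w \<le> w"
      using that w(1) by simp
    then show ?thesis
      using that w(2) by (simp add: r_def)
  qed

  have N_lower: "(1 / \<zeta>) ^ t \<le> real (batch_size N0 \<zeta> t)" for t
    by (rule batch_size_lower[OF N0 \<zeta>])
  have N1: "1 \<le> batch_size N0 \<zeta> t" for t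
  proof -
    have "1 \<le> (1 / \<zeta>) ^ t"
      using \<zeta> by (intro one_le_power) simp
    then show ?thesis
      using N_lower[of t] by linarith
  qed
  have inv_N: "v / real (batch_size N0 \<zeta> t) \<le> v * \<zeta> ^ t" if "0 \<le> v" for v t
  proof -
    have "v / real (batch_size N0 \<zeta> t) \<le> v / (1 / \<zeta>) ^ t"
      using that N_lower[of t] N1[of t] \<zeta>
      by (intro divide_left_mono mult_pos_pos) (auto simp: Suc_le_eq)
    then show ?thesis
      by (simp add: power_one_over)
  qed
  obtain a b where ab: "0 \<le> a" "0 \<le> b"
    and int: "\<And>t. 1 \<le> t \<Longrightarrow> integrable M (\<lambda>\<omega>. (norm (x t \<omega> - xstar))\<^sup>2)"
    and rec: "\<And>t. 1 \<le> t \<Longrightarrow> u (Suc t) \<le>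
      q * u t + (\<mu> / L)\<^sup>2 / (1 - \<mu>) * ((a + b * u t) / real (batch_size N0 \<zeta> t))"
    and gap: "\<And>t. 1 \<le> t \<Longrightarrow>
      expectation_le M (\<lambda>\<omega>. ?g (x (Suc t) \<omega>) - ?g xstar)
        ((a + b * u t) / real (batch_size N0 \<zeta> t) / 2 + u (Suc t) / 2 + L / (2 * \<mu>) * u t)"
    unfolding u_def q_def
    using expected_step[OF noise \<mu> probability N1 algorithm solution] by blast
  define \<kappa> where "\<kappa> = (\<mu> / L)\<^sup>2 / (1 - \<mu>)"
  have \<kappa>: "0 \<le> \<kappa>"
    using \<mu> by (simp add: \<kappa>_def)
  have u0: "0 \<le> u t" for t
    unfolding u_def by (intro Bochner_Integration.integral_nonneg) auto
  obtain C where C: "C > 0" "\<And>t. 1 \<le> t \<Longrightarrow> u t \<le> C * r ^ t"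
  proof (rule perturbed_contraction_rate[where u=u and q=q and r=r and \<zeta>=\<zeta> and a="\<kappa> * a" and b="\<kappa> * b"])
    fix t :: nat assume "1 \<le> t"
    from rec[OF this] have "u (Suc t) \<le> q * u t + \<kappa> * ((a + b * u t) / real (batch_size N0 \<zeta> t))"
      by (simp add: \<kappa>_def)
    also have "\<dots> \<le> q * u t + \<kappa> * ((a + b * u t) * \<zeta> ^ t)"
      using \<kappa> ab u0[of t] by (intro add_left_mono mult_left_mono inv_N) auto
    finally show "u (Suc t) \<le> q * u t + (\<kappa> * a + \<kappa> * b * u t) * \<zeta> ^ t"
      by (simp add: algebra_simps)
  qed (use u0 q r \<zeta> \<kappa> ab in auto)

  have mono: "expectation_le M Y \<delta> \<Longrightarrow> \<delta> \<le> \<delta>' \<Longrightarrow> expectation_le M Y \<delta>'" for Y \<delta> \<delta>'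
    by (auto simp: expectation_le_def)
  have optimal: "optimal_value X P F \<phi> = ?g xstar"
    unfolding optimal_value_def using solution
    by (intro cInf_eq_minimum) (auto simp: is_arg_min_def not_less)
  define K where "K = (a + b * C) / 2 + C / 2 + L / (2 * \<mu>) * C"
  have "0 < K"
    using ab C(1) \<mu> L_pos by (simp add: K_def add_nonneg_pos)
  \<comment> \<open>The step from iterate \<open>t - 1\<close> to iterate \<open>t\<close> is bounded by \<open>r ^ (t - 1)\<close>, whence the division by \<open>r\<close>.\<close>
  have gap_rate: "expectation_le M (\<lambda>\<omega>. ?g (x t \<omega>) - ?g xstar) (K / r * r ^ t)"
    if t: "2 \<le> t" for t
  proof -
    obtain n where n: "t = Suc n" "1 \<le> n"
      using t by (cases t) auto
    have r01: "0 < r" "r < 1"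
      using q r \<rho>(2) by auto
    have \<zeta>r: "\<zeta> ^ n \<le> r ^ n"
      using r \<zeta> by (intro power_mono) auto
    have "r ^ n \<le> 1"
      using r01 by (intro power_le_one) auto
    then have "u n \<le> C"
      using C(2)[OF n(2)] C(1) by (smt (verit) mult_left_le)
    then have "(a + b * u n) / real (batch_size N0 \<zeta> n) \<le> (a + b * C) * \<zeta> ^ n"
      using ab u0[of n] \<zeta> by (intro order_trans[OF inv_N] mult_right_mono add_left_mono mult_left_mono) auto
    also have "\<dots> \<le> (a + b * C) * r ^ n"
      using ab C(1) \<zeta>r by (intro mult_left_mono) auto
    finally have 1: "(a + b * u n) / real (batch_size N0 \<zeta> n) \<le> (a + b * C) * r ^ n" .
    have "u (Suc n) \<le> C * r ^ Suc n"
      by (rule C(2)) simp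
    also have "\<dots> \<le> C * r ^ n"
      using C(1) r01 by (intro mult_left_mono power_decreasing) auto
    finally have 2: "u (Suc n) \<le> C * r ^ n" .
    have 3: "L / (2 * \<mu>) * u n \<le> L / (2 * \<mu>) * (C * r ^ n)"
      using C(2)[OF n(2)] \<mu> L_pos by (intro mult_left_mono) auto
    have "(a + b * u n) / real (batch_size N0 \<zeta> n) / 2 + u (Suc n) / 2 + L / (2 * \<mu>) * u n
        \<le> (a + b * C) * r ^ n / 2 + C * r ^ n / 2 + L / (2 * \<mu>) * (C * r ^ n)"
      by (intro add_mono divide_right_mono 1 2 3) auto
    also have "\<dots> = K * r ^ n"
      by (simp add: K_def ring_distribs)
    also have "\<dots> = K / r * r ^ t"
      using r01 by (simp add: n(1))
    finally show ?thesis
      using gap[OF n(2)] unfolding n(1) by (rule mono[rotated])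
  qed
  have dist_rate: "expectation_le M (\<lambda>\<omega>. (norm (x t \<omega> - xstar))\<^sup>2) (C * r ^ t)" if "2 \<le> t" for t
    using int[of t] C(2)[of t] that by (simp add: expectation_le_def u_def)
  have "0 < K / r"
    using \<open>0 < K\<close> q r(1) by simp
  note gap_complexity = geometric_rate_complexity[
      where achieves="\<lambda>t. expectation_le M (\<lambda>\<omega>. ?g (x t \<omega>) - ?g xstar)",
      OF gap_rate mono \<open>0 < K / r\<close> \<zeta>(1) r(2,3) \<rho>(2) N0 w(1) sharp]
  note dist_complexity = geometric_rate_complexity[
      where achieves="\<lambda>t. expectation_le M (\<lambda>\<omega>. (norm (x t \<omega> - xstar))\<^sup>2)",
      OF dist_rate mono C(1) \<zeta>(1) r(2,3) \<rho>(2) N0 w(1) sharp]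
  show ?thesis
    unfolding optimal w_def[symmetric]
    by (rule conjI; rule gap_complexity dist_complexity)
qed

end
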